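(* The Lie algebra of $\mathrm{Iso}_{\mathrm{sub}}(\mathbb{S}^7_{\mathrm{QH}})\cap O(8)$ coincides with $$\mathfrak{g}_6=\mathrm{span}_{\mathbb{R}}\big(\{A_iA_j : 1\le i<j\le5 \text{ or } (i,j)=(6,7)\}\cup\{A_6,A_7\}\big)\subset\mathfrak{so}(8).$$ In particular, $\dim\mathrm{Iso}_{\mathrm{sub}}(\mathbb{S}^7_{\mathrm{QH}})\ge\dim\mathfrak{g}_6=13$.
   Context: Let $A_1,\dots,A_7\in\mathfrak{so}(8)$ be a fixed family of real skew-symmetric $8\times 8$ matrices with $A_iA_j+A_jA_i=-2\delta_{ij}I$ for $i,j=1,\dots,7$. $\mathbb{S}^7\subset\mathbb{R}^8$ is the unit sphere. $\mathbb{S}^7_{\mathrm{QH}}=(\mathbb{S}^7,\mathcal{D}_{\mathrm{QH}},g)$ is the subriemannian (SR) manifold whose distribution $(\mathcal{D}_{\mathrm{QH}})_q$ is the orthogonal complement in $T_q\mathbb{S}^7$ of $\mathrm{span}\{A_6q,A_7q,A_6A_7q\}$ (the horizontal space of the quaternionic Hopf fibration), with $g$ the restriction to $\mathcal{D}_{\mathrm{QH}}$ of the standard Riemannian metric of $\mathbb{S}^7$. An SR isometry of an SR manifold $(M,\mathcal{H},g)$ is a diffeomorphism $\Phi:M\to M$ with $d\Phi_q(\mathcal{H}_q)\subset\mathcal{H}_{\Phi(q)}$ and such that $d\Phi_q:(\mathcal{H}_q,g_q)\to(\mathcal{H}_{\Phi(q)},g_{\Phi(q)})$ is an isometry for every $q\in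 M$. $\mathrm{Iso}_{\mathrm{sub}}(M)$ denotes the group of all SR isometries, which for the structures considered here is a Lie group. $O(8)$ acts on $\mathbb{S}^7$ by left multiplication, and its elements are identified with the induced diffeomorphisms of $\mathbb{S}^7$; the intersection $\mathrm{Iso}_{\mathrm{sub}}(\mathbb{S}^7_{\mathrm{QH}})\cap O(8)$ is a closed (Lie) subgroup of $O(8)$. *)

theory Defs
  imports "HOL-Analysis.Analysis"
begin

section \<open>Smooth maps on subsets of Euclidean space\<close>

text \<open>The set S is meant to be open; the derivative in the successor case is taken in all
  directions v, so that every iterated partial derivative up to order k is continuous on S.\<close>

primrec C_k_on ::
  "nat \<Rightarrow> 'a::euclidean_space set \<Rightarrow> ('a \<Rightarrow> 'b::euclidean_space) \<Rightarrow> bool" where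
  "C_k_on 0 S f \<longleftrightarrow> continuous_on S f"
| "C_k_on (Suc k) S f \<longleftrightarrow>
     (\<forall>x\<in>S. f differentiable (at x)) \<and>
     (\<forall>v. C_k_on k S (\<lambda>x. frechet_derivative f (at x) v))"

definition smooth_on_open ::
  "'a::euclidean_space set \<Rightarrow> ('a \<Rightarrow> 'b::euclidean_space) \<Rightarrow> bool" where
  "smooth_on_open S f \<longleftrightarrow> (\<forall>k. C_k_on k S f)"

text \<open>For an embedded submanifold M: f is smooth on M if it extends smoothly to an open
  neighbourhood of each point of M.\<close>

definition smooth_on_submanifold ::
  "'a::euclidean_space set \<Rightarrow> ('a \<Rightarrow> 'b::euclidean_space) \<Rightarrow> bool" where
  "smooth_on_submanifold M f \<longleftrightarrow>
     (\<forall>q\<in>M. \<exists>U F. open U \<and> q \<in> U \<and> smooth_on_open U F \<and> (\<forall>x\<in>U \<inter> M. F x = f x))"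

definition diffeomorphism_of :: "'a::euclidean_space set \<Rightarrow> ('a \<Rightarrow> 'a) \<Rightarrow> bool" where
  "diffeomorphism_of M f \<longleftrightarrow>
     bij_betw f M M \<and> smooth_on_submanifold M f \<and> smooth_on_submanifold M (inv_into M f)"

text \<open>The derivative relative to M. As a linear map on the ambient space it is not unique, but its
  values on vectors tangent to M are, and it is only ever applied to such vectors.\<close>

definition differential_on ::
  "'a::euclidean_space set \<Rightarrow> ('a \<Rightarrow> 'a) \<Rightarrow> 'a \<Rightarrow> 'a \<Rightarrow> 'a" where
  "differential_on M f q = frechet_derivative f (at q within M)"

section \<open>Subriemannian isometries\<close>

text \<open>A subriemannian manifold is given by an embedded submanifold M of a Euclidean space,
  a distribution H of constant rank (H q being a subspace of the tangent space at q) and an inner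
  product g q on H q. As the rank is constant, the inclusion together with the invariance of g makes
  the differential a linear isometry of H q onto H (f q).

  The isometries are undefined off M, so that two of them are equal in HOL exactly if they are equal
  as maps on M.\<close>

definition Iso_sub ::
  "'a::euclidean_space set \<Rightarrow> ('a \<Rightarrow> 'a set) \<Rightarrow> ('a \<Rightarrow> 'a \<Rightarrow> 'a \<Rightarrow> real) \<Rightarrow> ('a \<Rightarrow> 'a) set" where
  "Iso_sub M H g =
     {f \<in> extensional M. diffeomorphism_of M f \<and>
        (\<forall>q\<in>M. differential_on M f q ` H q \<subseteq> H (f q) \<and>
               (\<forall>u\<in>H q. \<forall>v\<in>H q.
                  g (f q) (differential_on M f q u) (differential_on M f q v) = g q u v))}"

text \<open>Topology of uniform convergence, which for compact M is the compact-open topology, the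
  standard topology of isometry groups.\<close>

definition uniform_topology :: "'a::euclidean_space set \<Rightarrow> ('a \<Rightarrow> 'a) set \<Rightarrow> ('a \<Rightarrow> 'a) topology" where
  "uniform_topology M G = subtopology (mtopology_of (cfunspace (top_of_set M) euclidean_metric)) G"

text \<open>The dimension of a Lie group is that of its underlying topological manifold.\<close>

definition manifold_of_dim :: "nat \<Rightarrow> 'a topology \<Rightarrow> bool" where
  "manifold_of_dim n X \<longleftrightarrow>
     Hausdorff_space X \<and> second_countable X \<and>
     (\<forall>x\<in>topspace X. \<exists>U V. openin X U \<and> x \<in> U \<and> openin (Euclidean_space n) V \<and>
        subtopology X U homeomorphic_space subtopology (Euclidean_space n) V)"

section \<open>Matrix groups\<close>

definition so :: "(real^'n^'n) set" where
  "so = {X. transpose X = - X}"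

definition matrix_exp :: "real^'n^'n \<Rightarrow> real^'n^'n" where
  "matrix_exp X = (\<Sum>k. (1 / fact k) *\<^sub>R (((**) X ^^ k) (mat 1)))"

text \<open>The Lie algebra of a closed group of matrices.\<close>

definition matrix_lie_algebra :: "(real^'n^'n) set \<Rightarrow> (real^'n^'n) set" where
  "matrix_lie_algebra G = {X. \<forall>t. matrix_exp (t *\<^sub>R X) \<in> G}"

section \<open>The quaternionic Hopf structure on the seven-sphere\<close>

abbreviation S7 :: "(real^8) set" where
  "S7 \<equiv> sphere 0 1"

definition tangent_S7 :: "real^8 \<Rightarrow> (real^8) set" where
  "tangent_S7 q = {v. orthogonal q v}"

text \<open>The family is indexed by 1 to 7; other values of A are irrelevant.\<close>

definition clifford_family :: "(nat \<Rightarrow> real^8^8) \<Rightarrow> bool" where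
  "clifford_family A \<longleftrightarrow>
     (\<forall>i\<in>{1..7}. A i \<in> so) \<and>
     (\<forall>i\<in>{1..7}. \<forall>j\<in>{1..7}.
        A i ** A j + A j ** A i = (if i = j then - 2 else 0) *\<^sub>R mat 1)"

definition D_QH :: "(nat \<Rightarrow> real^8^8) \<Rightarrow> real^8 \<Rightarrow> (real^8) set" where
  "D_QH A q = tangent_S7 q \<inter>
     orthogonal_comp (span {A 6 *v q, A 7 *v q, (A 6 ** A 7) *v q})"

definition Iso_QH :: "(nat \<Rightarrow> real^8^8) \<Rightarrow> (real^8 \<Rightarrow> real^8) set" where
  "Iso_QH A = Iso_sub S7 (D_QH A) (\<lambda>q u v. u \<bullet> v)"

definition Iso_QH_O8 :: "(nat \<Rightarrow> real^8^8) \<Rightarrow> (real^8^8) set" where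
  "Iso_QH_O8 A = {Q. orthogonal_matrix Q \<and> restrict ((*v) Q) S7 \<in> Iso_QH A}"

definition g6 :: "(nat \<Rightarrow> real^8^8) \<Rightarrow> (real^8^8) set" where
  "g6 A = span ({A i ** A j | i j. (1 \<le> i \<and> i < j \<and> j \<le> 5) \<or> (i, j) = (6, 7)} \<union> {A 6, A 7})"

end

theory Submission
  imports Defs
begin

text \<open>Let $L_q$ be the quaternionic line spanned by $q, A_6q, A_7q, A_6A_7q$, so that the
  distribution at q is the orthogonal complement of $L_q$. Differentiating
  $\<langle>e^{tX}v, A_k e^{tX}q\<rangle> = 0$ for horizontal v shows that $[A_k, X]q \<in> L_q$ for all q and
  k = 6, 7. A matrix that preserves every quaternionic line is itself a quaternion, so $[A_k, X]$ lies
  in $\<bbbH> = \<langle>1, A_6, A_7, A_6A_7\<rangle>$. The 28 matrices $A_j$ and $A_iA_j$ form an orthogonal basis of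
  so(8) adapted to conjugation by the $A_m$. If X is orthogonal to g6, then $[A_k, X]$ is orthogonal
  to $\<bbbH>$ and hence 0; but every basis element outside g6 anticommutes with $A_6$ or $A_7$, so X = 0.
  Conversely, for X in g6 the inner products $\<langle>e^{tX}v, B e^{tX}q\<rangle>$ with B = $A_6, A_7, A_6A_7$ solve a
  linear system with a skew matrix and therefore stay 0.

  Near 0 the exponential is injective and Lipschitz, so it maps a ball of g6 injectively and
  continuously into the isometry group; invariance of dimension then bounds the dimension of any
  chart from below.\<close>

section \<open>The matrix exponential\<close>

lemma inner_transpose: "transpose M \<bullet> transpose N = M \<bullet> N" for M :: "real^'n^'m"
  unfolding inner_vec_def transpose_def by (simp, rule sum.swap)

lemma norm_transpose: "norm (transpose M) = norm (M :: real^'n^'m)"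
  by (simp add: norm_eq_sqrt_inner inner_transpose)

lemma norm_matrix_vector_mult_le: "norm (M *v x) \<le> norm M * norm x" for M :: "real^'n^'m"
proof -
  have "norm (M *v x) = L2_set (\<lambda>i. \<bar>M $ i \<bullet> x\<bar>) UNIV"
    by (simp add: norm_vec_def matrix_mult_dot)
  also have "\<dots> \<le> L2_set (\<lambda>i. norm (M $ i) * norm x) UNIV"
    by (intro L2_set_mono Cauchy_Schwarz_ineq2) auto
  also have "\<dots> = norm M * norm x"
    by (simp add: norm_vec_def L2_set_left_distrib)
  finally show ?thesis .
qed

text \<open>Each row of \<open>M ** N\<close> is \<open>transpose N\<close> applied to the
  corresponding row of \<open>M\<close>, so the vector bound applies row by row. The Euclidean norm
  of a matrix is its Frobenius norm.\<close>

lemma norm_matrix_mult_le: "norm (M ** N) \<le> norm M * norm N"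
  for M :: "real^'n^'m" and N :: "real^'k^'n"
proof -
  have row: "(M ** N) $ i = transpose N *v (M $ i)" for i
    by (simp add: vec_eq_iff matrix_matrix_mult_def matrix_vector_mult_def transpose_def mult.commute)
  have "norm (M ** N) = L2_set (\<lambda>i. norm (transpose N *v (M $ i))) UNIV"
    by (simp add: norm_vec_def[of "M ** N"] row)
  also have "\<dots> \<le> L2_set (\<lambda>i. norm N * norm (M $ i)) UNIV"
    by (intro L2_set_mono) (metis norm_matrix_vector_mult_le norm_transpose, simp)
  also have "\<dots> = norm M * norm N"
    by (simp add: norm_vec_def[of M] L2_set_right_distrib[symmetric] mult.commute)
  finally show ?thesis .
qed

lemma bounded_bilinear_matrix_mult:
  "bounded_bilinear ((**) :: real^'n^'m \<Rightarrow> real^'k^'n \<Rightarrow> real^'k^'m)"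
proof (intro bounded_bilinear.intro exI[of _ 1] allI)
  show "norm (M ** N) \<le> norm M * norm N * 1" for M :: "real^'n^'m" and N :: "real^'k^'n"
    by (simp add: norm_matrix_mult_le)
qed (simp_all add: vec_eq_iff matrix_matrix_mult_def sum.distrib sum_distrib_left algebra_simps)

interpretation matrix_mult: bounded_bilinear "(**) :: real^'n^'m \<Rightarrow> real^'k^'n \<Rightarrow> real^'k^'m"
  by (rule bounded_bilinear_matrix_mult)

lemma bounded_bilinear_matrix_vector_mult:
  "bounded_bilinear ((*v) :: real^'n^'m \<Rightarrow> real^'n \<Rightarrow> real^'m)"
  by (intro bounded_bilinear.intro exI[of _ 1])
     (auto simp: matrix_vector_mult_add_rdistrib matrix_vector_right_distrib
                 scaleR_matrix_vector_assoc matrix_vector_mult_scaleR norm_matrix_vector_mult_le)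

interpretation matrix_vector_mult: bounded_bilinear "(*v) :: real^'n^'m \<Rightarrow> real^'n \<Rightarrow> real^'m"
  by (rule bounded_bilinear_matrix_vector_mult)

section \<open>Power series and derivative of the exponential\<close>

definition matrix_power :: "real^'n^'n \<Rightarrow> nat \<Rightarrow> real^'n^'n" where
  "matrix_power X k = ((**) X ^^ k) (mat 1)"

lemma matrix_power_simps [simp]:
  "matrix_power X 0 = mat 1" "matrix_power X (Suc k) = X ** matrix_power X k"
  by (simp_all add: matrix_power_def)

lemma matrix_exp_eq: "matrix_exp X = (\<Sum>k. matrix_power X k /\<^sub>R fact k)"
  by (simp add: matrix_exp_def matrix_power_def divide_inverse)

lemma matrix_power_scaleR: "matrix_power (t *\<^sub>R X) k = t ^ k *\<^sub>R matrix_power X k"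
  by (induction k) (simp_all add: matrix_mult.scaleR_left matrix_mult.scaleR_right mult.commute)

lemma norm_matrix_power_le: "norm (matrix_power X k) \<le> norm (mat 1 :: real^'n^'n) * norm X ^ k"
  for X :: "real^'n^'n"
proof (induction k)
  case (Suc k)
  have "norm (matrix_power X (Suc k)) \<le> norm X * norm (matrix_power X k)"
    by (simp add: norm_matrix_mult_le)
  also have "\<dots> \<le> norm X * (norm (mat 1 :: real^'n^'n) * norm X ^ k)"
    by (intro mult_left_mono Suc) auto
  finally show ?case by (simp add: mult_ac)
qed simp

text \<open>The Frobenius norm of the identity is the square root of the size, hence the extra
  factor in \<open>norm_matrix_power_le\<close>. From exponent 1 on it disappears, which keeps the
  later constants independent of the size.\<close>

lemma norm_matrix_power_Suc_le: "norm (matrix_power X (Suc k)) \<le> norm X ^ Suc k"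
  for X :: "real^'n^'n"
proof (induction k)
  case (Suc k)
  have "norm (matrix_power X (Suc (Suc k))) \<le> norm X * norm (matrix_power X (Suc k))"
    unfolding matrix_power_simps(2)[of X "Suc k"] by (rule norm_matrix_mult_le)
  also have "\<dots> \<le> norm X * norm X ^ Suc k"
    by (intro mult_left_mono Suc) auto
  finally show ?case by simp
qed simp

lemma summable_matrix_exp: "summable (\<lambda>k. norm (matrix_power X k /\<^sub>R fact k))"
  for X :: "real^'n^'n"
proof (rule summable_comparison_test)
  show "\<exists>N. \<forall>k\<ge>N. norm (norm (matrix_power X k /\<^sub>R fact k))
          \<le> norm (mat 1 :: real^'n^'n) * (inverse (fact k) * norm X ^ k)"
    using norm_matrix_power_le[of X]
    by (auto simp: divide_simps mult.commute mult.left_commute intro!: exI[of _ 0])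
  show "summable (\<lambda>k. norm (mat 1 :: real^'n^'n) * (inverse (fact k) * norm X ^ k))"
    by (intro summable_mult summable_exp)
qed

text \<open>A functional turns the matrix series into a real power series in \<open>t\<close>, to
  which termwise differentiation applies.\<close>

lemma bounded_linear_matrix_exp_sums:
  fixes X :: "real^'n^'n" and f :: "real^'n^'n \<Rightarrow> real"
  assumes "bounded_linear f"
  shows "(\<lambda>k. f (matrix_power X k) / fact k * t ^ k) sums f (matrix_exp (t *\<^sub>R X))"
proof -
  interpret f: bounded_linear f by fact
  have "(\<lambda>k. matrix_power (t *\<^sub>R X) k /\<^sub>R fact k) sums matrix_exp (t *\<^sub>R X)"
    unfolding matrix_exp_eq by (rule summable_sums[OF summable_norm_cancel[OF summable_matrix_exp]])
  from f.sums[OF this] show ?thesis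
    by (simp add: matrix_power_scaleR f.scaleR divide_inverse mult_ac)
qed

lemma matrix_exp_has_vector_derivative:
  fixes X :: "real^'n^'n"
  shows "((\<lambda>t. matrix_exp (t *\<^sub>R X)) has_vector_derivative X ** matrix_exp (t *\<^sub>R X)) (at t)"
proof -
  have "((\<lambda>t. f (matrix_exp (t *\<^sub>R X))) has_real_derivative f (X ** matrix_exp (t *\<^sub>R X))) (at t)"
    if f: "bounded_linear f" for f :: "real^'n^'n \<Rightarrow> real"
  proof -
    let ?c = "\<lambda>k. f (matrix_power X k) / fact k"
    have fX: "bounded_linear (\<lambda>M. f (X ** M))"
      by (intro bounded_linear_compose[OF f] matrix_mult.bounded_linear_right)
    note S = bounded_linear_matrix_exp_sums[OF f, of X]
    have "((\<lambda>t. \<Sum>k. ?c k * t ^ k) has_real_derivative (\<Sum>k. diffs ?c k * t ^ k)) (at t)"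
      by (intro termdiffs_strong_converges_everywhere sums_summable[OF S])
    \<comment> \<open>\<open>diffs\<close> multiplies coefficient k + 1 by k + 1, which lowers the
      factorial; what remains is the series of the functional that first multiplies by
      \<open>X\<close> from the left.\<close>
    moreover have "diffs ?c = (\<lambda>k. f (X ** matrix_power X k) / fact k)"
      by (rule ext) (simp add: diffs_def del: of_nat_Suc)
    ultimately show ?thesis
      using S bounded_linear_matrix_exp_sums[OF fX, of X] by (simp add: sums_iff)
  qed
  note * = this
  show ?thesis
    unfolding has_vector_derivative_def
  proof (subst has_derivative_componentwise_within, rule ballI)
    fix i :: "real^'n^'n"
    have "((\<lambda>t. matrix_exp (t *\<^sub>R X) \<bullet> i) has_real_derivative (X ** matrix_exp (t *\<^sub>R X)) \<bullet> i) (at t)"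
      by (rule *) (rule bounded_linear_inner_left)
    then show "((\<lambda>t. matrix_exp (t *\<^sub>R X) \<bullet> i) has_derivative
        (\<lambda>h. (h *\<^sub>R (X ** matrix_exp (t *\<^sub>R X))) \<bullet> i)) (at t)"
      by (simp add: has_field_derivative_def mult_commute_abs)
  qed
qed

lemma matrix_exp_0 [simp]: "matrix_exp 0 = (mat 1 :: real^'n^'n)"
proof -
  have "matrix_power 0 k = (if k = 0 then mat 1 else (0 :: real^'n^'n))" for k
    by (cases k) (simp_all add: matrix_mult.zero_left)
  then have "(\<lambda>k. matrix_power (0 :: real^'n^'n) k /\<^sub>R fact k) = (\<lambda>k. if k = 0 then mat 1 else 0)"
    by auto
  then show ?thesis
    using sums_single[of 0 "\<lambda>_. mat 1 :: real^'n^'n"] by (simp add: matrix_exp_eq sums_iff)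
qed

text \<open>Telescoping: the next difference is \<open>X\<close> times the previous one plus
  \<open>X - Y\<close> times a power of \<open>Y\<close>. Exponents start at 1 so that the norm of
  the identity does not enter.\<close>

lemma norm_matrix_power_diff_le:
  fixes X Y :: "real^'n^'n" and r :: real
  assumes "norm X \<le> r" "norm Y \<le> r"
  shows "norm (matrix_power X (Suc k) - matrix_power Y (Suc k)) \<le> real (Suc k) * r ^ k * norm (X - Y)"
proof (induction k)
  case (Suc k)
  have r: "0 \<le> r" using assms(1) norm_ge_zero order_trans by blast
  let ?p = "\<lambda>Z. matrix_power Z (Suc k)"
  have "matrix_power X (Suc (Suc k)) - matrix_power Y (Suc (Suc k))
      = X ** (?p X - ?p Y) + (X - Y) ** ?p Y"
    unfolding matrix_power_simps(2)[of _ "Suc k"]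
    by (simp only: matrix_mult.diff_left matrix_mult.diff_right) simp
  also have "norm \<dots> \<le> norm X * norm (?p X - ?p Y) + norm (X - Y) * norm (?p Y)"
    by (intro norm_triangle_le add_mono norm_matrix_mult_le)
  also have "\<dots> \<le> r * (Suc k * r ^ k * norm (X - Y)) + norm (X - Y) * r ^ Suc k"
    using norm_matrix_power_Suc_le[of Y k] power_mono[OF assms(2) norm_ge_zero, of "Suc k"]
    by (intro add_mono mult_mono assms Suc) (auto simp: r)
  finally show ?case by (simp add: algebra_simps)
qed simp

text \<open>The terms of orders 0 and 1 cancel against \<open>X - Y\<close>. In order k + 2 the
  factor k + 2 of the power estimate lowers the factorial, leaving r^(k+1)/(k+1)!, and these add up
  to \<open>exp r - 1\<close>.\<close>

lemma matrix_exp_near_identity: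
  fixes X Y :: "real^'n^'n"
  assumes X: "norm X \<le> r" and Y: "norm Y \<le> r"
  shows "norm (matrix_exp X - matrix_exp Y - (X - Y)) \<le> (exp r - 1) * norm (X - Y)"
proof -
  define a where "a = (\<lambda>k. (matrix_power X k - matrix_power Y k) /\<^sub>R fact k)"
  have "summable (\<lambda>k. matrix_power Z k /\<^sub>R fact k)" for Z :: "real^'n^'n"
    by (rule summable_norm_cancel[OF summable_matrix_exp])
  then have a: "a sums (matrix_exp X - matrix_exp Y)"
    unfolding a_def matrix_exp_eq scaleR_diff_right by (intro sums_diff summable_sums)
  then have "(\<lambda>k. a (k + 2)) sums (matrix_exp X - matrix_exp Y - (\<Sum>k<2. a k))"
    by (rule sums_split_initial_segment)
  also have "(\<Sum>k<2. a k) = X - Y"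
    by (simp add: a_def numeral_2_eq_2)
  finally have tail: "(\<lambda>k. a (k + 2)) sums (matrix_exp X - matrix_exp Y - (X - Y))" .
  have bound: "norm (a (k + 2)) \<le> inverse (fact (k + 1)) * r ^ (k + 1) * norm (X - Y)" for k
  proof -
    have "norm (a (k + 2)) \<le> (Suc (k + 1) * r ^ (k + 1) * norm (X - Y)) / fact (Suc (k + 1))"
      using norm_matrix_power_diff_le[OF X Y, of "k + 1"]
      by (simp add: a_def divide_inverse mult.commute mult_right_mono del: matrix_power_simps fact_Suc)
    also have "\<dots> = inverse (fact (k + 1)) * r ^ (k + 1) * norm (X - Y)"
      by (simp add: divide_simps)
    finally show ?thesis .
  qed
  have "(\<lambda>k. inverse (fact k) * r ^ k) sums exp r"
    using exp_converges[of r] by (simp add: divide_inverse)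
  from sums_split_initial_segment[OF this, of 1]
  have "(\<lambda>k. inverse (fact (k + 1)) * r ^ (k + 1)) sums (exp r - 1)"
    by simp
  then have e: "(\<lambda>k. inverse (fact (k + 1)) * r ^ (k + 1) * norm (X - Y)) sums ((exp r - 1) * norm (X - Y))"
    by (rule sums_mult2)
  show ?thesis
    using norm_suminf_le[OF bound sums_summable[OF e]]
    unfolding sums_unique[OF e, symmetric] sums_unique[OF tail, symmetric] .
qed

text \<open>For radius 1/4 the constant \<open>exp r - 1\<close> is below 1, so the exponential is
  the identity plus a contraction.\<close>

lemma matrix_exp_local:
  fixes X Y :: "real^'n^'n"
  assumes "norm X \<le> 1/4" "norm Y \<le> 1/4"
  shows "norm (matrix_exp X - matrix_exp Y) \<le> 2 * norm (X - Y)"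
    and "matrix_exp X = matrix_exp Y \<Longrightarrow> X = Y"
proof -
  define d where "d = norm (X - Y)"
  have e: "exp (1/4) < (2 :: real)"
    using exp_half_le2 exp_less_mono[of "1/4 :: real" "1/2"] by linarith
  note N = matrix_exp_near_identity[OF assms, folded d_def]
  have "(exp (1/4) - 1) * d \<le> 1 * d"
    using e by (intro mult_right_mono) (auto simp: d_def)
  then show "norm (matrix_exp X - matrix_exp Y) \<le> 2 * norm (X - Y)"
    using N norm_triangle_sub[of "matrix_exp X - matrix_exp Y" "X - Y"] by (simp add: d_def)
  assume "matrix_exp X = matrix_exp Y"
  then have "d \<le> (exp (1/4) - 1) * d" using N by (simp add: d_def norm_minus_commute)
  then have "(2 - exp (1/4)) * d \<le> 0" by (simp add: algebra_simps)
  then have "d \<le> 0" using e by (simp add: mult_le_0_iff)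
  then show "X = Y" by (simp add: d_def)
qed

section \<open>An orthogonal basis of so(8)\<close>

lemma inner_matrix_vector_mult: "(M *v v) \<bullet> w = v \<bullet> (transpose M *v w)"
  for M :: "real^'n^'m"
  using dot_lmul_matrix[of v "transpose M" w] by (simp only: vector_transpose_matrix)

lemma inner_matrix_mult_left: "(M ** N) \<bullet> P = N \<bullet> (transpose M ** P)"
  for M :: "real^'n^'m" and N :: "real^'k^'n"
proof -
  have "(M ** N) \<bullet> P = (\<Sum>i\<in>UNIV. \<Sum>j\<in>UNIV. \<Sum>k\<in>UNIV. M$i$k * N$k$j * P$i$j)"
    by (simp add: inner_vec_def matrix_matrix_mult_def sum_distrib_right)
  also have "\<dots> = (\<Sum>j\<in>UNIV. \<Sum>i\<in>UNIV. \<Sum>k\<in>UNIV. M$i$k * N$k$j * P$i$j)"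
    by (rule sum.swap)
  also have "\<dots> = (\<Sum>j\<in>UNIV. \<Sum>k\<in>UNIV. \<Sum>i\<in>UNIV. M$i$k * N$k$j * P$i$j)"
    by (rule sum.cong[OF refl], rule sum.swap)
  also have "\<dots> = (\<Sum>k\<in>UNIV. \<Sum>j\<in>UNIV. \<Sum>i\<in>UNIV. M$i$k * N$k$j * P$i$j)"
    by (rule sum.swap)
  also have "\<dots> = N \<bullet> (transpose M ** P)"
    by (simp add: inner_vec_def matrix_matrix_mult_def transpose_def sum_distrib_left mult_ac)
  finally show ?thesis .
qed

lemma inner_matrix_mult_right: "(N ** M) \<bullet> P = N \<bullet> (P ** transpose M)"
  for M :: "real^'k^'n" and N :: "real^'n^'m"
proof -
  have "(N ** M) \<bullet> P = (transpose M ** transpose N) \<bullet> transpose P"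
    by (metis inner_transpose matrix_transpose_mul)
  also have "\<dots> = transpose N \<bullet> transpose (P ** transpose M)"
    by (simp add: inner_matrix_mult_left matrix_transpose_mul)
  finally show ?thesis by (simp add: inner_transpose)
qed

section \<open>Dimension of the skew-symmetric matrices\<close>

lemma subspace_so: "subspace (so :: (real^'n^'n) set)"
proof -
  have "transpose (X + Y) = transpose X + transpose Y" "transpose (c *\<^sub>R X) = c *\<^sub>R transpose X"
    "transpose (0 :: real^'n^'n) = 0" for X Y :: "real^'n^'n" and c
    by (simp_all add: vec_eq_iff transpose_def)
  then show ?thesis by (simp add: so_def subspace_def)
qed

lemma mem_so_iff: "X \<in> so \<longleftrightarrow> (\<forall>v w. (X *v v) \<bullet> w + v \<bullet> (X *v w) = 0)"
  for X :: "real^'n^'n"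
proof
  assume "X \<in> so"
  then show "\<forall>v w. (X *v v) \<bullet> w + v \<bullet> (X *v w) = 0"
    by (simp add: so_def inner_matrix_vector_mult matrix_vector_mult.minus_left)
next
  assume *: "\<forall>v w. (X *v v) \<bullet> w + v \<bullet> (X *v w) = 0"
  have "transpose X *v w = - X *v w" for w
  proof (rule vector_eq_ldot[THEN iffD1], rule allI)
    show "v \<bullet> (transpose X *v w) = v \<bullet> (- X *v w)" for v
      using *[rule_format, of v w]
      by (simp add: inner_matrix_vector_mult matrix_vector_mult.minus_left)
  qed
  then show "X \<in> so" by (simp add: so_def matrix_eq)
qed

lemma axis_axis_nth: "axis i (axis j (1::real)) $ a $ b = (if i = a \<and> j = b then 1 else 0)"
  by (cases "a = i"; cases "b = j") (simp_all add: axis_def)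

lemma scaleR_axis_diff_nth:
  "(c *\<^sub>R (axis i (axis j 1) - axis j (axis i 1) :: real^'n^'n)) $ a $ b
     = (if i = a \<and> j = b then c else 0) - (if i = b \<and> j = a then c else 0)"
  unfolding vector_scaleR_component vector_minus_component axis_axis_nth real_scaleR_def
  by (simp only: if_distrib[of "(*) c"] right_diff_distrib conj_commute mult_1_right mult_zero_right)

text \<open>The differences of matrix units E_ij - E_ji, one for each unordered pair, span. This
  bound later shows that 28 independent elements form a basis.\<close>

lemma dim_so_le: "dim (so :: (real^'n^'n) set) \<le> (\<Sum>j<CARD('n). j)"
proof -
  \<comment> \<open>An enumeration puts an order on the index type, so that each unordered pair is
    chosen once.\<close>
  from ex_bij_betw_nat_finite[OF finite[of "UNIV :: 'n set"]]
  obtain g where "bij_betw g {0..<CARD('n)} (UNIV :: 'n set)" ..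
  then have g: "bij_betw g {..<CARD('n)} (UNIV :: 'n set)"
    by (simp only: atLeast0LessThan)
  define d :: "'n \<Rightarrow> 'n \<Rightarrow> real^'n^'n"
    where "d = (\<lambda>i j. axis i (axis j 1) - axis j (axis i 1))"
  let ?I = "SIGMA j:{..<CARD('n)}. {..<j}"
  let ?U = "(\<lambda>(j, i). d (g j) (g i)) ` ?I"
  have d: "d k l \<in> span ?U" for k l
  proof -
    have "k \<in> g ` {..<CARD('n)}" "l \<in> g ` {..<CARD('n)}"
      using g by (simp_all add: bij_betw_def)
    then obtain j i where ji: "k = g j" "l = g i" "j < CARD('n)" "i < CARD('n)"
      by (elim imageE) simp
    consider "i < j" | "i = j" | "j < i" by linarith
    then show ?thesis
    proof cases
      case 1
      then show ?thesis using ji by (auto intro!: span_base image_eqI[of _ _ "(j, i)"])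
    next
      case 2
      then show ?thesis using ji by (simp add: d_def span_zero)
    next
      case 3
      then have "d l k \<in> span ?U" using ji by (auto intro!: span_base image_eqI[of _ _ "(i, j)"])
      then have "- d l k \<in> span ?U" by (rule span_neg)
      then show ?thesis by (simp add: d_def)
    qed
  qed
  have "so \<subseteq> span ?U"
  proof
    fix X :: "real^'n^'n" assume "X \<in> so"
    then have T: "transpose X = - X"
      by (simp add: so_def)
    have X: "X $ j $ i = - X $ i $ j" for i j
    proof -
      have "X $ j $ i = transpose X $ i $ j" by (simp add: transpose_def)
      also have "\<dots> = - X $ i $ j" unfolding T by simp
      finally show ?thesis .
    qed
    \<comment> \<open>Every unordered pair occurs twice in the double sum, hence the halves.\<close>
    have "(\<Sum>i\<in>UNIV. \<Sum>j\<in>UNIV. (X $ i $ j / 2) *\<^sub>R d i j) = X"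
    proof (simp only: vec_eq_iff, intro allI)
      fix a b
      have delta: "(\<Sum>i\<in>UNIV. \<Sum>j\<in>UNIV. if i = k \<and> j = l then X $ i $ j / 2 else 0) = X $ k $ l / 2"
        for k l
      proof -
        have "(\<Sum>j\<in>UNIV. if i = k \<and> j = l then X $ i $ j / 2 else 0)
            = (if i = k then X $ k $ l / 2 else 0)" for i
          by (cases "i = k") simp_all
        then show ?thesis by simp
      qed
      have "(\<Sum>i\<in>UNIV. \<Sum>j\<in>UNIV. (X $ i $ j / 2) *\<^sub>R d i j) $ a $ b
        = (\<Sum>i\<in>UNIV. \<Sum>j\<in>UNIV. (if i = a \<and> j = b then X $ i $ j / 2 else 0)
            - (if i = b \<and> j = a then X $ i $ j / 2 else 0))"
      proof -
        have "((X $ i $ j / 2) *\<^sub>R d i j) $ a $ b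
            = (if i = a \<and> j = b then X $ i $ j / 2 else 0)
              - (if i = b \<and> j = a then X $ i $ j / 2 else 0)" for i j
          unfolding d_def by (rule scaleR_axis_diff_nth)
        then show ?thesis by (simp only: sum_component)
      qed
      also have "\<dots> = X $ a $ b"
        unfolding sum_subtractf delta X[of a b] by simp
      finally show "(\<Sum>i\<in>UNIV. \<Sum>j\<in>UNIV. (X $ i $ j / 2) *\<^sub>R d i j) $ a $ b = X $ a $ b" .
    qed
    moreover have "(\<Sum>i\<in>UNIV. \<Sum>j\<in>UNIV. (X $ i $ j / 2) *\<^sub>R d i j) \<in> span ?U"
      by (intro span_sum span_scale d)
    ultimately show "X \<in> span ?U" by simp
  qed
  then have "dim (so :: (real^'n^'n) set) \<le> card ?U"
    by (intro dim_le_card) auto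
  also have "\<dots> \<le> card ?I" by (intro card_image_le) auto
  also have "\<dots> = (\<Sum>j<CARD('n). j)" by simp
  finally show ?thesis .
qed

definition commutator :: "real^'n^'n \<Rightarrow> real^'n^'n \<Rightarrow> real^'n^'n" where
  "commutator M N = M ** N - N ** M"

lemma linear_commutator: "linear (commutator M)"
proof (rule linearI)
  show "commutator M (X + Y) = commutator M X + commutator M Y" for X Y
    unfolding commutator_def matrix_mult.add_left matrix_mult.add_right by simp
  show "commutator M (r *\<^sub>R X) = r *\<^sub>R commutator M X" for r X
    unfolding commutator_def matrix_mult.scaleR_left matrix_mult.scaleR_right scaleR_diff_right ..
qed

text \<open>The adjoint of multiplication by \<open>M\<close> is multiplication by its transpose, so
  ad \<open>M\<close> is skew. This moves a bracket from an unknown matrix onto a known one.\<close>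

lemma inner_commutator_so:
  assumes "M \<in> so"
  shows "commutator M X \<bullet> N = - (X \<bullet> commutator M N)"
proof -
  have M: "transpose M = - M" using assms by (simp add: so_def)
  show ?thesis
    unfolding commutator_def inner_diff_left inner_diff_right inner_matrix_mult_left[of M X]
      inner_matrix_mult_right[of X M] M matrix_mult.minus_left matrix_mult.minus_right by simp
qed

section \<open>The Clifford relations and the 28 basis elements\<close>

locale clifford =
  fixes A :: "nat \<Rightarrow> real^8^8"
  assumes clifford_family: "clifford_family A"
begin

lemma A_so: "i \<in> {1..7} \<Longrightarrow> A i \<in> so"
  by (rule clifford_family[unfolded clifford_family_def, THEN conjunct1, THEN bspec])

lemma A_relation:
  "\<lbrakk>i \<in> {1..7}; j \<in> {1..7}\<rbrakk> \<Longrightarrow> A i ** A j + A j ** A i = (if i = j then - 2 else 0) *\<^sub>R mat 1"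
  by (rule clifford_family[unfolded clifford_family_def, THEN conjunct2, THEN bspec, THEN bspec])

lemma A_transpose: "i \<in> {1..7} \<Longrightarrow> transpose (A i) = - A i"
  using A_so by (simp add: so_def)

lemma A_square: "i \<in> {1..7} \<Longrightarrow> A i ** A i = - mat 1"
proof -
  assume "i \<in> {1..7}"
  then have "A i ** A i + A i ** A i = (-2) *\<^sub>R mat 1"
    by (simp only: A_relation simp_thms if_True)
  then have "2 *\<^sub>R (A i ** A i) = 2 *\<^sub>R (- mat 1)" by (simp add: scaleR_2)
  then show ?thesis by (simp only: scaleR_cancel_left) simp
qed

lemma A_anticommute: "\<lbrakk>i \<in> {1..7}; j \<in> {1..7}; i \<noteq> j\<rbrakk> \<Longrightarrow> A i ** A j = - (A j ** A i)"
  unfolding eq_neg_iff_add_eq_0 by (simp only: A_relation if_False scaleR_zero_left)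

text \<open>Conjugation by A m is an isometry, and M and N are eigenvectors of it for the eigenvalues
  1 and -1.\<close>

lemma orthogonal_if_signs_differ:
  assumes m: "m \<in> {1..7}"
    and M: "A m ** M = M ** A m" and N: "A m ** N = - (N ** A m)"
  shows "M \<bullet> N = 0"
proof -
  have 1: "transpose (A m) ** (A m ** N) = N"
    using m by (simp add: A_transpose matrix_mul_assoc matrix_mult.minus_left A_square)
  have 2: "(N ** A m) ** transpose (A m) = N"
    using m by (simp add: A_transpose matrix_mul_assoc[symmetric] matrix_mult.minus_right A_square)
  have "M \<bullet> N = (A m ** M) \<bullet> (A m ** N)"
    by (simp add: inner_matrix_mult_left 1)
  also have "\<dots> = - ((M ** A m) \<bullet> (N ** A m))" by (simp add: M N)
  also have "\<dots> = - (M \<bullet> N)" by (simp only: inner_matrix_mult_right[of M] 2)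
  finally show ?thesis by simp
qed

text \<open>Second component 0 encodes the single matrix \<open>A j\<close>, and i > 0 the product
  \<open>A i ** A j\<close>; one triangle of 1 + ... + 7 = 28 pairs covers both kinds.\<close>

definition so_index :: "(nat \<times> nat) set" where
  "so_index = (SIGMA j:{1..7}. {0..<j})"

definition so_basis :: "nat \<times> nat \<Rightarrow> real^8^8" where
  "so_basis = (\<lambda>(j, i). if i = 0 then A j else A i ** A j)"

text \<open>The indices m for which A m anticommutes with the basis element.\<close>

definition anti_set :: "nat \<times> nat \<Rightarrow> nat set" where
  "anti_set = (\<lambda>(j, i). if i = 0 then {1..7} - {j} else {i, j})"

text \<open>Moving \<open>A m\<close> past one factor costs a sign unless the indices agree. For a
  product the two signs multiply, and the result is -1 exactly if m is one of the two distinct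
  indices.\<close>

lemma A_so_basis:
  assumes m: "m \<in> {1..7}" and p: "p \<in> so_index"
  shows "A m ** so_basis p = (if m \<in> anti_set p then - (so_basis p ** A m) else so_basis p ** A m)"
proof -
  obtain j i where ji: "p = (j, i)" "j \<in> {1..7}" "i < j" using p by (auto simp: so_index_def)
  show ?thesis
  proof (cases "i = 0")
    case True
    then show ?thesis using m ji A_anticommute[of m j]
      by (auto simp: so_basis_def anti_set_def)
  next
    case False
    then have i: "i \<in> {1..7}" using ji by auto
    have c: "A m ** A k = (if m = k then A k ** A m else - (A k ** A m))" if "k \<in> {1..7}" for k
      using m that A_anticommute[of m k] by auto
    have "A m ** (A i ** A j) = (A m ** A i) ** A j" by (simp add: matrix_mul_assoc)
    also have "\<dots> = (if m = i then 1 else -1) *\<^sub>R (A i ** (A m ** A j))"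
      by (simp add: c[OF i] matrix_mul_assoc matrix_mult.minus_left)
    also have "\<dots> = ((if m = i then 1 else -1) * (if m = j then 1 else -1)) *\<^sub>R (A i ** A j ** A m)"
      by (simp add: c[OF ji(2)] matrix_mul_assoc matrix_mult.minus_right)
    finally show ?thesis using False ji by (auto simp: so_basis_def anti_set_def)
  qed
qed

text \<open>Single matrices give sets of size 6 and products sets of size 2, so the two kinds cannot
  collide; within a kind the set determines the index, as i < j.\<close>

lemma inj_on_anti_set: "inj_on anti_set so_index"
proof (rule inj_onI)
  fix p p' assume p: "p \<in> so_index" "p' \<in> so_index" and eq: "anti_set p = anti_set p'"
  obtain j i j' i' where ji: "p = (j, i)" "j \<in> {1..7}" "i < j" "p' = (j', i')" "j' \<in> {1..7}" "i' < j'"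
    using p by (auto simp: so_index_def)
  have card: "card ({1..7} - {k}) \<noteq> card {a, b}" if "k \<in> {1..7}" for a b k :: nat
    using that card_insert_le_m1[of 2 "{b}" a] by (simp add: card_Diff_singleton)
  show "p = p'"
  proof (cases "i = 0"; cases "i' = 0")
    assume "i = 0" "i' = 0"
    then have "{1..7} - {j} = {1..7} - {j'}" using eq ji by (simp add: anti_set_def)
    then show ?thesis using ji \<open>i = 0\<close> \<open>i' = 0\<close> by blast
  next
    assume "i = 0" "i' \<noteq> 0"
    then show ?thesis using eq ji card[of j i' j'] by (simp add: anti_set_def)
  next
    assume "i \<noteq> 0" "i' = 0"
    then show ?thesis using eq ji card[of j' i j] by (simp add: anti_set_def)
  next
    assume "i \<noteq> 0" "i' \<noteq> 0"
    then show ?thesis using eq ji by (auto simp: anti_set_def doubleton_eq_iff)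
  qed
qed

text \<open>Different sets of anticommuting indices provide some m for which conjugation by
  \<open>A m\<close> has opposite eigenvalues on the two elements.\<close>

lemma so_basis_orthogonal:
  assumes p: "p \<in> so_index" and p': "p' \<in> so_index" and "p \<noteq> p'"
  shows "so_basis p \<bullet> so_basis p' = 0"
proof -
  have "anti_set p \<noteq> anti_set p'"
    using assms inj_on_anti_set by (auto dest: inj_onD)
  moreover have "anti_set p \<subseteq> {1..7}" "anti_set p' \<subseteq> {1..7}"
    using p p' by (auto simp: anti_set_def so_index_def split: if_splits)
  ultimately obtain m where m: "m \<in> {1..7}" "m \<in> anti_set p \<longleftrightarrow> m \<notin> anti_set p'"
    by blast
  show ?thesis
    using orthogonal_if_signs_differ[OF m(1), of "so_basis p" "so_basis p'"]
      orthogonal_if_signs_differ[OF m(1), of "so_basis p'" "so_basis p"] m(2)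
      A_so_basis[OF m(1) p] A_so_basis[OF m(1) p']
    by (auto simp: inner_commute)
qed

lemma so_basis_so: "p \<in> so_index \<Longrightarrow> so_basis p \<in> so"
proof -
  have "A i ** A j \<in> so" if "i \<in> {1..7}" "j \<in> {1..7}" "i \<noteq> j" for i j
  proof -
    have "transpose (A i ** A j) = A j ** A i"
      using that by (simp add: A_transpose matrix_transpose_mul matrix_mult.minus_left matrix_mult.minus_right)
    also have "\<dots> = - (A i ** A j)" using that by (intro A_anticommute) auto
    finally show ?thesis by (simp add: so_def)
  qed
  then show "p \<in> so_index \<Longrightarrow> so_basis p \<in> so"
    using A_so by (auto simp: so_index_def so_basis_def)
qed

lemma A_nonzero: "i \<in> {1..7} \<Longrightarrow> A i \<noteq> 0"
proof
  assume "i \<in> {1..7}" "A i = 0"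
  then have "mat 1 = (0 :: real^8^8)" using A_square[of i] by (simp add: matrix_mult.zero_left)
  then have "(mat 1 :: real^8^8) $ 1 $ 1 = 0" by simp
  then show False by (simp add: mat_def)
qed

lemma so_basis_nonzero: "p \<in> so_index \<Longrightarrow> so_basis p \<noteq> 0"
proof -
  have "A i ** A j \<noteq> 0" if "i \<in> {1..7}" "j \<in> {1..7}" for i j
  proof
    assume "A i ** A j = 0"
    then have "A i ** (A i ** A j) = 0" by (simp add: matrix_mult.zero_right)
    then show False using that A_nonzero
      by (simp add: matrix_mul_assoc A_square matrix_mult.minus_left)
  qed
  then show "p \<in> so_index \<Longrightarrow> so_basis p \<noteq> 0"
    using A_nonzero by (auto simp: so_index_def so_basis_def split: if_splits)
qed

lemma inj_on_so_basis: "inj_on so_basis so_index"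
proof (rule inj_onI, rule ccontr)
  fix p p' assume p: "p \<in> so_index" "p' \<in> so_index" "so_basis p = so_basis p'" "p \<noteq> p'"
  then have "so_basis p \<bullet> so_basis p = 0"
    using so_basis_orthogonal[of p p'] by simp
  then show False using so_basis_nonzero[OF p(1)] by simp
qed

lemma independent_so_basis: "independent (so_basis ` so_index)"
  using so_basis_orthogonal so_basis_nonzero
  by (intro pairwise_orthogonal_independent) (auto simp: pairwise_def orthogonal_def)

text \<open>An independent subset of so(8) with at least \<open>dim so\<close> elements spans
  it.\<close>

lemma so_subset_span_basis: "so \<subseteq> span (so_basis ` so_index)"
proof (rule card_ge_dim_independent)
  show "so_basis ` so_index \<subseteq> so" using so_basis_so by auto
  show "independent (so_basis ` so_index)" by (rule independent_so_basis)
  have "card (so_basis ` so_index) = (\<Sum>j\<in>{1..7}. j)"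
    by (subst card_image[OF inj_on_so_basis]) (simp add: so_index_def)
  \<comment> \<open>The additional index 0 contributes nothing to the sum.\<close>
  also have "\<dots> = (\<Sum>j<CARD(8). j)" by (intro sum.mono_neutral_left) auto
  finally show "dim (so :: (real^8^8) set) \<le> card (so_basis ` so_index)"
    using dim_so_le[where 'n = 8] by (simp only:)
qed

text \<open>The triangle starts at i = 1, which leaves out the single matrices \<open>A 1\<close> to
  \<open>A 5\<close>. The three extra pairs encode \<open>A 6 ** A 7\<close>, \<open>A 6\<close> and
  \<open>A 7\<close>.\<close>

definition g6_index :: "(nat \<times> nat) set" where
  "g6_index = (SIGMA j:{1..5}. {1..<j}) \<union> {(7, 6), (6, 0), (7, 0)}"

lemma g6_index_subset: "g6_index \<subseteq> so_index"
  by (auto simp: g6_index_def so_index_def)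

lemma g6_eq: "g6 A = span (so_basis ` g6_index)"
proof -
  let ?P = "SIGMA j:{1..5}. {1..<j}"
  have "{A i ** A j | i j. (1 \<le> i \<and> i < j \<and> j \<le> 5) \<or> (i, j) = (6, 7)}
      = insert (A 6 ** A 7) {A i ** A j | i j. 1 \<le> i \<and> i < j \<and> j \<le> 5}"
    by auto
  also have "{A i ** A j | i j. 1 \<le> i \<and> i < j \<and> j \<le> 5} = (\<lambda>(j, i). A i ** A j) ` ?P"
    by (force simp: image_iff)
  also have "\<dots> = so_basis ` ?P"
    by (rule image_cong) (auto simp: so_basis_def)
  finally show ?thesis
    by (simp add: g6_def g6_index_def image_Un so_basis_def insert_commute)
qed

lemma g6_subset_so: "g6 A \<subseteq> so"
  unfolding g6_eq using so_basis_so g6_index_subset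
  by (intro span_minimal subspace_so) auto

lemma dim_g6: "dim (g6 A) = 13"
proof -
  have "independent (so_basis ` g6_index)"
    by (rule independent_mono[OF independent_so_basis image_mono[OF g6_index_subset]])
  then have "dim (g6 A) = card (so_basis ` g6_index)"
    by (simp add: g6_eq dim_eq_card_independent)
  also have "\<dots> = card g6_index"
    by (rule card_image[OF inj_on_subset[OF inj_on_so_basis g6_index_subset]])
  also have "\<dots> = card (SIGMA j:{1..5::nat}. {1..<j}) + card {(7, 6), (6, 0), (7, 0 :: nat) :: nat \<times> nat}"
    unfolding g6_index_def by (intro card_Un_disjoint) auto
  also have "card (SIGMA j:{1..5::nat}. {1..<j}) = 10"
  proof -
    have "{1..5} = {1, 2, 3, 4, 5 :: nat}" by auto
    then show ?thesis by simp
  qed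
  finally show ?thesis by simp
qed

section \<open>Quaternionic lines\<close>

text \<open>The quaternion a + bi + cj + dk acting on R^8, with \<open>A 6\<close>,
  \<open>A 7\<close>, \<open>A 6 ** A 7\<close> as i, j, k.\<close>

definition quat :: "real \<Rightarrow> real \<Rightarrow> real \<Rightarrow> real \<Rightarrow> real^8^8" where
  "quat a b c d = a *\<^sub>R mat 1 + b *\<^sub>R A 6 + c *\<^sub>R A 7 + d *\<^sub>R (A 6 ** A 7)"

lemma quat_units:
  "A 6 ** A 6 = - mat 1" "A 7 ** A 7 = - mat 1" "A 7 ** A 6 = - (A 6 ** A 7)"
  "A 6 ** (A 6 ** A 7) = - A 7" "(A 6 ** A 7) ** A 6 = A 7"
  "A 7 ** (A 6 ** A 7) = A 6" "(A 6 ** A 7) ** A 7 = - A 6"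
  "(A 6 ** A 7) ** (A 6 ** A 7) = - mat 1"
proof -
  show 1: "A 6 ** A 6 = - mat 1" "A 7 ** A 7 = - mat 1" "A 7 ** A 6 = - (A 6 ** A 7)"
    using A_square A_anticommute[of 7 6] by simp_all
  show 2: "A 6 ** (A 6 ** A 7) = - A 7" "(A 6 ** A 7) ** A 7 = - A 6"
    using 1 by (simp_all add: matrix_mul_assoc[symmetric] matrix_mult.minus_right)
       (simp add: matrix_mul_assoc 1 matrix_mult.minus_left)
  have "(A 6 ** A 7) ** A 6 = - (A 6 ** (A 6 ** A 7))"
    using 1 by (simp add: matrix_mul_assoc[symmetric] matrix_mult.minus_right)
  then show 3: "(A 6 ** A 7) ** A 6 = A 7" using 2 by simp
  have "A 7 ** (A 6 ** A 7) = - (A 6 ** A 7 ** A 7)"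
    using 1 by (simp add: matrix_mul_assoc matrix_mult.minus_left)
  then show "A 7 ** (A 6 ** A 7) = A 6" using 2 by simp
  have "(A 6 ** A 7) ** (A 6 ** A 7) = ((A 6 ** A 7) ** A 6) ** A 7"
    by (simp add: matrix_mul_assoc)
  then show "(A 6 ** A 7) ** (A 6 ** A 7) = - mat 1" using 3 1 by simp
qed

lemma quat_scale: "r *\<^sub>R quat a b c d = quat (r*a) (r*b) (r*c) (r*d)"
  by (simp add: quat_def algebra_simps)

lemma quat_add: "quat a b c d + quat a' b' c' d' = quat (a+a') (b+b') (c+c') (d+d')"
  by (simp add: quat_def algebra_simps)

text \<open>Hamilton's product: left multiplication by a unit permutes the coordinates up to sign,
  and bilinearity does the rest.\<close>

lemma quat_mult:
  "quat a b c d ** quat a' b' c' d' =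
     quat (a*a' - b*b' - c*c' - d*d') (a*b' + b*a' + c*d' - d*c')
          (a*c' - b*d' + c*a' + d*b') (a*d' + b*c' - c*b' + d*a')"
proof -
  have "quat a b c d ** M = a *\<^sub>R M + b *\<^sub>R (A 6 ** M) + c *\<^sub>R (A 7 ** M) + d *\<^sub>R (A 6 ** A 7 ** M)"
    for M :: "real^8^8"
    by (simp add: quat_def matrix_mult.add_left matrix_mult.scaleR_left)
  moreover have "A 6 ** quat a' b' c' d' = quat (-b') a' (-d') c'"
    "A 7 ** quat a' b' c' d' = quat (-c') d' a' (-b')"
    "(A 6 ** A 7) ** quat a' b' c' d' = quat (-d') (-c') b' a'"
    by (simp_all add: quat_def matrix_mult.add_right matrix_mult.scaleR_right quat_units)
  ultimately have "quat a b c d ** quat a' b' c' d' = a *\<^sub>R quat a' b' c' d' +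
      b *\<^sub>R quat (-b') a' (-d') c' + c *\<^sub>R quat (-c') d' a' (-b') + d *\<^sub>R quat (-d') (-c') b' a'"
    by (simp only:)
  then show ?thesis
    unfolding quat_scale quat_add by (simp add: algebra_simps)
qed

lemma quat_basis:
  "quat 1 0 0 0 = mat 1" "quat 0 1 0 0 = A 6" "quat 0 0 1 0 = A 7" "quat 0 0 0 1 = A 6 ** A 7"
  "quat 0 0 0 0 = 0"
  by (simp_all add: quat_def)

definition quats :: "(real^8^8) set" where
  "quats = {quat a b c d | a b c d. True}"

lemma subspace_quats: "subspace quats"
proof (rule subspaceI)
  show "0 \<in> quats" unfolding quats_def using quat_basis(5)[symmetric] by blast
  show "M + N \<in> quats" if "M \<in> quats" "N \<in> quats" for M N
    using that unfolding quats_def by (auto simp: quat_add) blast+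
  show "r *\<^sub>R M \<in> quats" if "M \<in> quats" for r M
    using that unfolding quats_def by (auto simp: quat_scale) blast+
qed

lemma quats_mult: "\<lbrakk>M \<in> quats; N \<in> quats\<rbrakk> \<Longrightarrow> M ** N \<in> quats"
  unfolding quats_def using quat_mult by blast

lemma quats_basis: "mat 1 \<in> quats" "A 6 \<in> quats" "A 7 \<in> quats" "A 6 ** A 7 \<in> quats"
  unfolding quats_def using quat_basis(1-4)[symmetric] by blast+

lemma quats_eq_span: "quats = span {mat 1, A 6, A 7, A 6 ** A 7}"
proof
  show "quats \<subseteq> span {mat 1, A 6, A 7, A 6 ** A 7}"
    by (auto simp: quats_def quat_def intro!: span_add span_scale intro: span_base)
  show "span {mat 1, A 6, A 7, A 6 ** A 7} \<subseteq> quats"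
    using quats_basis by (intro span_minimal subspace_quats) auto
qed

text \<open>The inverse is the conjugate divided by the squared quaternion norm
  \<open>n\<close>.\<close>

lemma quats_inverse:
  assumes "M \<in> quats" "M \<noteq> 0"
  obtains N where "N \<in> quats" "N ** M = mat 1"
proof -
  obtain a b c d where M: "M = quat a b c d" using assms by (auto simp: quats_def)
  define n where "n = a^2 + b^2 + c^2 + d^2"
  have "n \<noteq> 0"
    using assms(2) unfolding n_def M
    by (auto simp: add_nonneg_eq_0_iff quat_basis)
  have "quat a (-b) (-c) (-d) ** M = quat n 0 0 0"
    by (simp add: M quat_mult n_def power2_eq_square)
  then have "(inverse n *\<^sub>R quat a (-b) (-c) (-d)) ** M = mat 1"
    unfolding matrix_mult.scaleR_left using \<open>n \<noteq> 0\<close> by (simp add: quat_scale quat_basis)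
  moreover have "inverse n *\<^sub>R quat a (-b) (-c) (-d) \<in> quats"
    by (auto simp: quats_def quat_scale)
  ultimately show ?thesis using that by blast
qed

definition quat_line :: "real^8 \<Rightarrow> (real^8) set" where
  "quat_line q = (\<lambda>M. M *v q) ` quats"

lemma linear_matrix_vector_left: "linear (\<lambda>M :: real^8^8. M *v q)"
  by (rule bounded_linear.linear[OF matrix_vector_mult.bounded_linear_left])

lemma subspace_quat_line: "subspace (quat_line q)"
  unfolding quat_line_def by (intro linear_subspace_image linear_matrix_vector_left subspace_quats)

lemma quat_line_eq_span: "quat_line q = span {q, A 6 *v q, A 7 *v q, (A 6 ** A 7) *v q}"
  unfolding quat_line_def quats_eq_span
  by (simp add: linear_span_image[OF linear_matrix_vector_left, symmetric])

lemma mem_D_QH_iff: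
  "v \<in> D_QH A q \<longleftrightarrow> (\<forall>y \<in> {q, A 6 *v q, A 7 *v q, (A 6 ** A 7) *v q}. v \<bullet> y = 0)"
proof -
  let ?S = "{A 6 *v q, A 7 *v q, (A 6 ** A 7) *v q}"
  have "v \<in> orthogonal_comp (span ?S) \<longleftrightarrow> (\<forall>y\<in>?S. orthogonal v y)"
    unfolding orthogonal_comp_def mem_Collect_eq orthogonal_commute[of _ v]
    by (meson orthogonal_to_span span_base)
  then show ?thesis
    by (simp add: D_QH_def tangent_S7_def orthogonal_def inner_commute)
qed

text \<open>A double orthogonal complement in finite dimension. It makes membership in the line
  testable against horizontal vectors only.\<close>

lemma quat_line_D_QH: "quat_line q = orthogonal_comp (D_QH A q)"
proof -
  let ?S = "{q, A 6 *v q, A 7 *v q, (A 6 ** A 7) *v q}"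
  have "v \<in> D_QH A q \<longleftrightarrow> v \<in> orthogonal_comp (span ?S)" for v
    unfolding orthogonal_comp_def mem_Collect_eq orthogonal_commute[of _ v] mem_D_QH_iff
    unfolding orthogonal_def[symmetric] by (meson orthogonal_to_span span_base)
  then have "D_QH A q = orthogonal_comp (span ?S)" by blast
  then show ?thesis
    by (simp only: orthogonal_comp_self[OF subspace_span] quat_line_eq_span)
qed

lemma quat_line_trans: "q' \<in> quat_line q \<Longrightarrow> M \<in> quats \<Longrightarrow> M *v q' \<in> quat_line q"
  unfolding quat_line_def using quats_mult by (force simp: matrix_vector_mul_assoc)

text \<open>If $M_1 q + M_2 q' = 0$ with quaternions $M_1, M_2$ and $q'$ is not in the line of $q$,
  then both coefficients vanish; comparing $C(q + q') = Cq + Cq'$ shows that the quaternion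
  by which C acts does not depend on the line.\<close>

lemma quats_if_preserves_lines:
  assumes C: "\<And>q. C *v q \<in> quat_line q"
  shows "C \<in> quats"
proof -
  have "\<exists>M. \<forall>q. M q \<in> quats \<and> C *v q = M q *v q"
    using C unfolding quat_line_def by (intro choice) blast
  then obtain M where M: "\<And>q. M q \<in> quats" "\<And>q. C *v q = M q *v q" by blast
  \<comment> \<open>A nonzero quaternion is invertible, and its inverse preserves the line.\<close>
  have cancel: "q \<in> quat_line q'" if "N \<in> quats" "N \<noteq> 0" "N *v q \<in> quat_line q'" for N q q'
  proof -
    obtain N' where N': "N' \<in> quats" "N' ** N = mat 1" using quats_inverse \<open>N \<in> quats\<close> \<open>N \<noteq> 0\<close> by blast
    then have "N' *v (N *v q) = q" by (simp add: matrix_vector_mul_assoc)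
    then show ?thesis using quat_line_trans[OF that(3) N'(1)] by simp
  qed
  have const: "M q = M q'" if "q \<noteq> 0" "q' \<notin> quat_line q" for q q'
  proof -
    have d: "M x - M y \<in> quats" for x y
      using subspace_diff[OF subspace_quats] M(1) by blast
    have "M (q + q') *v (q + q') = M q *v q + M q' *v q'"
      using M(2) by (metis matrix_vector_right_distrib)
    then have eq: "(M q' - M (q + q')) *v q' = (M (q + q') - M q) *v q"
      by (simp add: matrix_vector_mult.diff_left matrix_vector_right_distrib algebra_simps)
    then have "(M q' - M (q + q')) *v q' \<in> quat_line q"
      using d by (auto simp: quat_line_def)
    \<comment> \<open>Otherwise \<open>cancel\<close> would put \<open>q'\<close> on the line of
      \<open>q\<close>.\<close>
    then have 1: "M q' - M (q + q') = 0" using cancel d that(2) by blast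
    then have "(M (q + q') - M q) *v q = 0" using eq by simp
    \<comment> \<open>The line of 0 is trivial, so \<open>cancel\<close> shows that a nonzero
      quaternion cannot annihilate \<open>q\<close>.\<close>
    moreover have "0 \<in> quat_line 0" "quat_line 0 = {0}"
      by (auto simp: quat_line_def intro: subspace_0[OF subspace_quats])
    ultimately have "M (q + q') - M q = 0" using cancel[of "M (q + q') - M q" q 0] d that(1) by auto
    with 1 show ?thesis by simp
  qed
  obtain q0 :: "real^8" where q0: "q0 \<noteq> 0" by (metis axis_eq_0_iff zero_neq_one)
  \<comment> \<open>A line has dimension at most 4 < 8, so there is a point \<open>q1\<close> off
    the line of \<open>q0\<close>.\<close>
  have "dim (quat_line q0) < DIM(real^8)"
  proof -
    have "dim (quat_line q0) \<le> card {q0, A 6 *v q0, A 7 *v q0, (A 6 ** A 7) *v q0}"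
      by (simp only: quat_line_eq_span dim_span) (intro dim_le_card' finite.intros)
    also have "\<dots> \<le> 4" by (auto intro!: card_insert_le_m1)
    finally show ?thesis by simp
  qed
  then obtain q1 where q1: "q1 \<notin> quat_line q0"
    by (metis UNIV_eq_I dim_UNIV less_irrefl)
  have "C *v q = M q0 *v q" for q
  proof (cases "q = 0")
    case False
    show ?thesis
    proof (cases "q \<in> quat_line q0")
      case True
      \<comment> \<open>\<open>const\<close> cannot compare two points of one line directly; both
        \<open>q\<close> and \<open>q0\<close> are compared with \<open>q1\<close>.\<close>
      have "q1 \<notin> quat_line q"
      proof
        assume "q1 \<in> quat_line q"
        then obtain N where "N \<in> quats" "q1 = N *v q" by (auto simp: quat_line_def)
        then show False using q1 quat_line_trans[OF True] by blast
      qed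
      then show ?thesis using const[OF False] const[OF q0 q1] M(2) by metis
    qed (use const[OF q0] M(2) in metis)
  qed simp
  then show ?thesis using M(1) by (metis matrix_eq)
qed

text \<open>Bracketing with \<open>X\<close> acts on the span of the three imaginary units by a skew
  3 x 3 matrix. This condition is linear in \<open>X\<close>, so the generators suffice:
  \<open>A i ** A j\<close> with i < j \<le> 5 commutes with all units, and the remaining generators
  are units. Sharing a, b, c records the skewness, which later yields a conserved sum of
  squares.\<close>

lemma g6_commutator:
  assumes "X \<in> g6 A"
  shows "\<exists>a b c. commutator (A 6) X = a *\<^sub>R A 7 + b *\<^sub>R (A 6 ** A 7) \<and>
                 commutator (A 7) X = - a *\<^sub>R A 6 + c *\<^sub>R (A 6 ** A 7) \<and>
                 commutator (A 6 ** A 7) X = - b *\<^sub>R A 6 - c *\<^sub>R A 7"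
proof -
  have "subspace {X. \<exists>a b c. commutator (A 6) X = a *\<^sub>R A 7 + b *\<^sub>R (A 6 ** A 7) \<and>
                 commutator (A 7) X = - a *\<^sub>R A 6 + c *\<^sub>R (A 6 ** A 7) \<and>
                 commutator (A 6 ** A 7) X = - b *\<^sub>R A 6 - c *\<^sub>R A 7}" (is "subspace ?D")
  proof (rule subspaceI)
    show "0 \<in> ?D" by (auto simp: linear_0[OF linear_commutator] intro!: exI[of _ 0])
  next
    fix X Y assume "X \<in> ?D" "Y \<in> ?D"
    then obtain a b c a' b' c' where XY: "commutator (A 6) X = a *\<^sub>R A 7 + b *\<^sub>R (A 6 ** A 7)"
      "commutator (A 7) X = - a *\<^sub>R A 6 + c *\<^sub>R (A 6 ** A 7)"
      "commutator (A 6 ** A 7) X = - b *\<^sub>R A 6 - c *\<^sub>R A 7"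
      "commutator (A 6) Y = a' *\<^sub>R A 7 + b' *\<^sub>R (A 6 ** A 7)"
      "commutator (A 7) Y = - a' *\<^sub>R A 6 + c' *\<^sub>R (A 6 ** A 7)"
      "commutator (A 6 ** A 7) Y = - b' *\<^sub>R A 6 - c' *\<^sub>R A 7" by blast
    show "X + Y \<in> ?D"
      unfolding mem_Collect_eq
      by (rule exI[of _ "a + a'"], rule exI[of _ "b + b'"], rule exI[of _ "c + c'"])
         (simp add: linear_add[OF linear_commutator] XY algebra_simps)
  next
    fix r X assume "X \<in> ?D"
    then obtain a b c where X: "commutator (A 6) X = a *\<^sub>R A 7 + b *\<^sub>R (A 6 ** A 7)"
      "commutator (A 7) X = - a *\<^sub>R A 6 + c *\<^sub>R (A 6 ** A 7)"
      "commutator (A 6 ** A 7) X = - b *\<^sub>R A 6 - c *\<^sub>R A 7" by blast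
    show "r *\<^sub>R X \<in> ?D"
      unfolding mem_Collect_eq
      by (rule exI[of _ "r * a"], rule exI[of _ "r * b"], rule exI[of _ "r * c"])
         (simp add: linear_scale[OF linear_commutator] X algebra_simps)
  qed
  moreover have "so_basis ` g6_index \<subseteq> ?D"
  proof (rule image_subsetI)
    \<comment> \<open>Collecting equal summands produces a componentwise product with a numeral;
      this turns it back into a scalar multiple.\<close>
    have two: "2 * M = 2 *\<^sub>R M" for M :: "real^8^8"
      by (simp only: mult_2 scaleR_2)
    fix p assume "p \<in> g6_index"
    then consider j i where "p = (j, i)" "1 \<le> i" "i < j" "j \<le> 5" | "p = (7, 6)" | "p = (6, 0)" | "p = (7, 0)"
      by (auto simp: g6_index_def)
    then show "so_basis p \<in> ?D"
    proof cases
      case (1 j i)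
      then have p: "p \<in> so_index" by (auto simp: so_index_def)
      have c: "A m ** so_basis p = so_basis p ** A m" if "m \<in> {6, 7}" for m
        using that A_so_basis[OF _ p, of m] 1 by (auto simp: anti_set_def)
      have "A 6 ** A 7 ** so_basis p = A 6 ** (so_basis p ** A 7)"
        by (simp add: matrix_mul_assoc[symmetric] c)
      also have "\<dots> = so_basis p ** (A 6 ** A 7)"
        by (simp add: matrix_mul_assoc c)
      finally have c67: "A 6 ** A 7 ** so_basis p = so_basis p ** (A 6 ** A 7)" .
      show ?thesis
        unfolding mem_Collect_eq
        by (rule exI[of _ 0], rule exI[of _ 0], rule exI[of _ 0]) (simp add: commutator_def c c67)
    next
      \<comment> \<open>The witnesses in this and the next two cases come from [i, k] = -2j, [j, i]
        = -2k and [i, j] = 2k.\<close>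
      case 2
      show ?thesis
        unfolding mem_Collect_eq
        by (rule exI[of _ "-2"], rule exI[of _ 0], rule exI[of _ 0])
           (simp add: 2 so_basis_def commutator_def quat_units two)
    next
      case 3
      show ?thesis
        unfolding mem_Collect_eq
        by (rule exI[of _ 0], rule exI[of _ 0], rule exI[of _ "-2"])
           (simp add: 3 so_basis_def commutator_def quat_units two)
    next
      case 4
      show ?thesis
        unfolding mem_Collect_eq
        by (rule exI[of _ 0], rule exI[of _ 2], rule exI[of _ 0])
           (simp add: 4 so_basis_def commutator_def quat_units two)
    qed
  qed
  ultimately show ?thesis
    using assms span_minimal unfolding g6_eq by blast
qed

text \<open>Split \<open>X\<close> into \<open>Z\<close> in g6 and \<open>Y\<close> orthogonal to
  g6. The brackets of \<open>Z\<close> are quaternions, so \<open>Y\<close> inherits the hypothesis,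
  and the argument for orthogonal matrices gives Y = 0.\<close>

lemma g6_if_commutators_vertical:
  assumes X: "X \<in> so"
    and V: "\<And>q k. k \<in> {6, 7} \<Longrightarrow> commutator (A k) X *v q \<in> quat_line q"
  shows "X \<in> g6 A"
proof -
  obtain Z Y where Z: "Z \<in> g6 A" and Y: "\<And>W. W \<in> g6 A \<Longrightarrow> Y \<bullet> W = 0" and XZY: "X = Z + Y"
    using orthogonal_subspace_decomp_exists[of "so_basis ` g6_index" X]
    unfolding g6_eq orthogonal_def by metis
  have "Y \<in> so"
    using X Z g6_subset_so XZY subspace_diff[OF subspace_so, of X Z] by auto
  have gens: "A 6 \<in> g6 A" "A 7 \<in> g6 A" "A 6 ** A 7 \<in> g6 A"
    unfolding g6_def by (auto intro: span_base)
  have commute: "A k ** Y = Y ** A k" if k: "k \<in> {6, 7}" for k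
  proof -
    have "commutator (A k) Z \<in> quats"
    proof -
      obtain a b c where abc: "commutator (A 6) Z = a *\<^sub>R A 7 + b *\<^sub>R (A 6 ** A 7)"
        "commutator (A 7) Z = - a *\<^sub>R A 6 + c *\<^sub>R (A 6 ** A 7)"
        using g6_commutator[OF Z] by blast
      have "commutator (A 6) Z \<in> quats" "commutator (A 7) Z \<in> quats"
        unfolding abc using quats_basis subspace_quats by (intro subspace_add subspace_scale; simp)+
      then show ?thesis using k by auto
    qed
    then have "commutator (A k) Y *v q \<in> quat_line q" for q
      using V[OF k, of q] subspace_diff[OF subspace_quat_line, of "commutator (A k) X *v q" q "commutator (A k) Z *v q"]
      by (auto simp: XZY linear_add[OF linear_commutator] matrix_vector_mult.add_left quat_line_def)
    then have C: "commutator (A k) Y \<in> quats" by (rule quats_if_preserves_lines)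
    \<comment> \<open>Skewness of ad \<open>A k\<close> moves the bracket from \<open>Y\<close> to
      \<open>N\<close>; the brackets of quaternion units lie in g6, to which \<open>Y\<close> is
      orthogonal.\<close>
    have perp: "commutator (A k) Y \<bullet> N = 0" if "N \<in> {mat 1, A 6, A 7, A 6 ** A 7}" for N
    proof -
      have "commutator (A k) N \<in> g6 A"
      proof -
        have closed: "0 \<in> g6 A" "\<And>M. M \<in> g6 A \<Longrightarrow> - M \<in> g6 A"
          "\<And>M M'. \<lbrakk>M \<in> g6 A; M' \<in> g6 A\<rbrakk> \<Longrightarrow> M - M' \<in> g6 A"
          unfolding g6_def by (simp_all add: span_zero span_neg span_diff)
        show ?thesis
          using k that unfolding commutator_def
          by (elim insertE emptyE;
              simp only: quat_units matrix_mul_lid matrix_mul_rid diff_self; intro closed gens)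
      qed
      then show ?thesis
        using Y k by (subst inner_commutator_so) (auto intro: A_so)
    qed
    have "orthogonal (commutator (A k) Y) (commutator (A k) Y)"
      by (rule orthogonal_to_span[OF C[unfolded quats_eq_span]]) (simp only: orthogonal_def perp)
    then have "A k ** Y - Y ** A k = 0" by (simp only: orthogonal_self commutator_def)
    then show ?thesis by (simp only: right_minus_eq)
  qed
  have "orthogonal Y (so_basis p)" if p: "p \<in> so_index" for p
  proof (cases "p \<in> g6_index")
    case True
    then show ?thesis using Y by (auto simp: g6_eq orthogonal_def intro: span_base)
  next
    case False
    obtain j i where p': "p = (j, i)" "j \<in> {1..7}" "i < j" using p by (auto simp: so_index_def)
    \<comment> \<open>Outside g6, a single \<open>A j\<close> has j \<le> 5 and anticommutes with
      \<open>A 6\<close>, while a product has j = 6 or j = 7 and anticommutes with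
      \<open>A j\<close>.\<close>
    have "\<exists>k\<in>{6, 7}. k \<in> anti_set p"
    proof (cases "i = 0")
      case True
      then have "j \<noteq> 6" using False p' by (auto simp: g6_index_def)
      then show ?thesis using True p' by (simp add: anti_set_def)
    next
      case i: False
      then have "\<not> j \<le> 5" using False p' by (auto simp: g6_index_def)
      then have "j \<in> {6, 7}" using p' by auto
      then show ?thesis using i p' by (auto simp: anti_set_def)
    qed
    then obtain k where k: "k \<in> {6, 7}" "k \<in> anti_set p" by blast
    then show ?thesis
      using orthogonal_if_signs_differ[of k Y "so_basis p"] commute A_so_basis[OF _ p, of k]
      by (auto simp: orthogonal_def)
  qed
  then have "orthogonal Y Y"
    using \<open>Y \<in> so\<close> so_subset_span_basis orthogonal_to_span[of Y "so_basis ` so_index" Y] by blast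
  then show ?thesis using Z XZY by (simp add: orthogonal_self)
qed

end

section \<open>Orthogonal matrices as subriemannian isometries\<close>

text \<open>The derivative within the sphere is a choice among several linear maps. Along a curve in
  the sphere with velocity \<open>v\<close> the chain rule reduces both candidates to a derivative
  in one variable, which is unique.\<close>

lemma frechet_derivative_sphere:
  fixes f :: "'a::euclidean_space \<Rightarrow> 'b::euclidean_space"
  assumes f: "(f has_derivative f') (at q within sphere 0 1)"
    and q: "norm q = 1" and v: "q \<bullet> v = 0"
  shows "frechet_derivative f (at q within sphere 0 1) v = f' v"
proof (cases "v = 0")
  case True
  have "f differentiable at q within sphere 0 1" using f by (rule differentiableI)
  then have "linear (frechet_derivative f (at q within sphere 0 1))"
    by (rule linear_frechet_derivative)
  moreover have "linear f'" using f by (rule has_derivative_linear)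
  ultimately show ?thesis by (simp add: True linear_0)
next
  case False
  \<comment> \<open>The great circle through \<open>q\<close> with initial velocity
    \<open>v\<close>; the division by \<open>norm v\<close> is why v = 0 is treated
    separately.\<close>
  define c where "c = (\<lambda>t. cos (t * norm v) *\<^sub>R q + (sin (t * norm v) / norm v) *\<^sub>R v)"
  have vv: "v \<bullet> q = 0" using v by (simp add: inner_commute)
  have c0: "c 0 = q" by (simp add: c_def)
  have "c t \<in> sphere 0 1" for t
  proof -
    have "c t \<bullet> c t = (cos (t * norm v))\<^sup>2 * (q \<bullet> q) + (sin (t * norm v) / norm v)\<^sup>2 * (v \<bullet> v)"
      by (simp add: c_def inner_add_left inner_add_right v vv power2_eq_square)
    also have "\<dots> = (cos (t * norm v))\<^sup>2 + (sin (t * norm v))\<^sup>2"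
      using False q by (simp add: power2_norm_eq_inner[symmetric] power_divide)
    also have "\<dots> = 1" by simp
    finally show ?thesis by (simp add: norm_eq_sqrt_inner)
  qed
  then have sub: "range c \<subseteq> sphere 0 1" by auto
  have c': "(c has_derivative (\<lambda>t. t *\<^sub>R v)) (at 0)"
    unfolding c_def using False by (auto intro!: derivative_eq_intros ext)
  have chain: "((f \<circ> c) has_derivative (g \<circ> (\<lambda>t. t *\<^sub>R v))) (at 0)"
    if "(f has_derivative g) (at q within sphere 0 1)" for g
    by (rule diff_chain_within[OF c']) (rule has_derivative_subset[OF _ sub], simp add: c0 that)
  have "(f has_derivative frechet_derivative f (at q within sphere 0 1)) (at q within sphere 0 1)"
    using f frechet_derivative_works differentiableI by blast
  from has_derivative_unique[OF chain[OF this] chain[OF f]] show ?thesis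
    by (auto simp: fun_eq_iff dest: spec[of _ 1])
qed

lemma C_k_on_const: "C_k_on k UNIV (\<lambda>x. c)"
  by (induction k arbitrary: c) simp_all

text \<open>The derivative of \<open>f\<close> is \<open>f\<close> at every point, so its value in a
  fixed direction is constant and a case split on k replaces induction.\<close>

lemma C_k_on_linear:
  assumes "linear f" shows "C_k_on k UNIV f"
proof (cases k)
  case 0
  then show ?thesis by (simp add: linear_continuous_on linear_conv_bounded_linear[symmetric] assms)
next
  case (Suc n)
  have d: "(f has_derivative f) (at x)" for x
    using assms by (simp add: bounded_linear_imp_has_derivative linear_conv_bounded_linear)
  have "frechet_derivative f (at x) = f" for x
    using frechet_derivative_at[OF d] by simp
  with d show ?thesis by (auto simp: Suc C_k_on_const intro: differentiableI)
qed

lemma smooth_on_submanifold_linear: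
  assumes "linear f" "\<And>x. x \<in> M \<Longrightarrow> g x = f x"
  shows "smooth_on_submanifold M g"
  unfolding smooth_on_submanifold_def smooth_on_open_def
  using assms C_k_on_linear by (intro ballI exI[of _ UNIV] exI[of _ f]) auto

lemma diffeomorphism_of_sphere_orthogonal:
  fixes Q :: "real^'n^'n"
  assumes "orthogonal_matrix Q"
  shows "diffeomorphism_of (sphere 0 1) (restrict ((*v) Q) (sphere 0 1))" (is "diffeomorphism_of ?S ?f")
proof -
  define P where "P = transpose Q"
  have P: "orthogonal_matrix P" using assms by (simp add: P_def)
  have PQ: "P *v (Q *v x) = x" "Q *v (P *v x) = x" for x
    using assms unfolding orthogonal_matrix_def P_def
    by (simp_all only: matrix_vector_mul_assoc matrix_vector_mul_lid)
  have n: "norm (Q *v x) = norm x" "norm (P *v x) = norm x" for x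
    using assms P orthogonal_transformation_matrix[of "(*v) Q"]
      orthogonal_transformation_matrix[of "(*v) P"]
    by (simp_all add: orthogonal_transformation)
  have bij: "bij_betw ?f ?S ?S"
    by (rule bij_betw_byWitness[where f' = "(*v) P"]) (auto simp: PQ n)
  have inv: "inv_into ?S ?f x = P *v x" if "x \<in> ?S" for x
    using that bij by (intro inv_into_f_eq) (auto simp: bij_betw_def PQ n)
  show ?thesis
    unfolding diffeomorphism_of_def
    using bij inv by (auto intro: smooth_on_submanifold_linear[OF matrix_vector_mul_linear])
qed

lemma differential_on_orthogonal:
  fixes Q :: "real^'n^'n"
  assumes "norm q = 1" "q \<bullet> v = 0"
  shows "differential_on (sphere 0 1) (restrict ((*v) Q) (sphere 0 1)) q v = Q *v v"
  unfolding differential_on_def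
proof (rule frechet_derivative_sphere[OF _ assms])
  have "((*v) Q has_derivative (*v) Q) (at q within sphere 0 1)"
    by (simp add: bounded_linear_imp_has_derivative)
  then show "(restrict ((*v) Q) (sphere 0 1) has_derivative (*v) Q) (at q within sphere 0 1)"
    by (rule has_derivative_transform[rotated 2]) (use assms in auto)
qed

text \<open>An orthogonal matrix is a diffeomorphism of the sphere, its differential on tangent
  vectors is the matrix itself, and it preserves inner products. Only the invariance of the
  distribution remains as a condition.\<close>

lemma mem_Iso_QH_O8_iff:
  "Q \<in> Iso_QH_O8 A \<longleftrightarrow> orthogonal_matrix Q \<and> (\<forall>q\<in>S7. \<forall>v\<in>D_QH A q. Q *v v \<in> D_QH A (Q *v q))"
proof -
  let ?f = "restrict ((*v) Q) S7"
  have d: "differential_on S7 ?f q v = Q *v v" if "q \<in> S7" "v \<in> D_QH A q" for q v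
    using that by (intro differential_on_orthogonal) (auto simp: D_QH_def tangent_S7_def orthogonal_def)
  have "(Q *v u) \<bullet> (Q *v v) = u \<bullet> v" if "orthogonal_matrix Q" for u v
    using that orthogonal_transformation_matrix[of "(*v) Q"] by (simp add: orthogonal_transformation_def)
  then show ?thesis
    unfolding Iso_QH_O8_def Iso_QH_def Iso_sub_def
    using diffeomorphism_of_sphere_orthogonal[of Q] d by (auto simp: image_subset_iff)
qed

section \<open>Differentiation along one-parameter groups\<close>

lemma matrix_exp_vector_derivative:
  "((\<lambda>t. matrix_exp (t *\<^sub>R X) *v v) has_vector_derivative X *v (matrix_exp (t *\<^sub>R X) *v v)) (at t)"
  for X :: "real^'n^'n"
  using bounded_linear.has_vector_derivative[OF matrix_vector_mult.bounded_linear_left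
      matrix_exp_has_vector_derivative[of X t], of v]
  by (simp add: matrix_vector_mul_assoc)

lemma matrix_exp_inner_derivative:
  fixes X M :: "real^'n^'n"
  shows "((\<lambda>t. (matrix_exp (t *\<^sub>R X) *v v) \<bullet> (M *v (matrix_exp (t *\<^sub>R X) *v w))) has_real_derivative
     (matrix_exp (t *\<^sub>R X) *v v) \<bullet> (M *v (X *v (matrix_exp (t *\<^sub>R X) *v w)))
     + (X *v (matrix_exp (t *\<^sub>R X) *v v)) \<bullet> (M *v (matrix_exp (t *\<^sub>R X) *v w))) (at t)"
proof -
  have "((\<lambda>t. M *v (matrix_exp (t *\<^sub>R X) *v w)) has_vector_derivative
      M *v (X *v (matrix_exp (t *\<^sub>R X) *v w))) (at t)"
    by (rule bounded_linear.has_vector_derivative[OF matrix_vector_mult.bounded_linear_right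
        matrix_exp_vector_derivative])
  from bounded_bilinear.has_vector_derivative[OF bounded_bilinear_inner
      matrix_exp_vector_derivative this]
  show ?thesis by (simp add: has_real_derivative_iff_has_vector_derivative)
qed

lemma commutator_vector_mult: "commutator M N *v x = M *v (N *v x) - N *v (M *v x)"
  by (simp add: commutator_def matrix_vector_mult.diff_left matrix_vector_mul_assoc)

text \<open>Skewness of \<open>X\<close> moves it to the other factor, where the two terms of the
  product rule merge into a bracket. Differentiation thus replaces \<open>M\<close> by
  \<open>commutator M X\<close>.\<close>

lemma matrix_exp_inner_derivative_so:
  fixes X M :: "real^'n^'n"
  assumes "X \<in> so"
  shows "((\<lambda>t. (matrix_exp (t *\<^sub>R X) *v v) \<bullet> (M *v (matrix_exp (t *\<^sub>R X) *v w))) has_real_derivative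
     (matrix_exp (t *\<^sub>R X) *v v) \<bullet> (commutator M X *v (matrix_exp (t *\<^sub>R X) *v w))) (at t)"
proof -
  let ?v = "matrix_exp (t *\<^sub>R X) *v v" and ?w = "matrix_exp (t *\<^sub>R X) *v w"
  have "(X *v ?v) \<bullet> (M *v ?w) = - (?v \<bullet> (X *v (M *v ?w)))"
    using assms unfolding mem_so_iff by (metis add_eq_0_iff2)
  then have "?v \<bullet> (M *v (X *v ?w)) + (X *v ?v) \<bullet> (M *v ?w) = ?v \<bullet> (commutator M X *v ?w)"
    by (simp add: commutator_vector_mult inner_diff_right)
  with matrix_exp_inner_derivative[of X v M w t] show ?thesis by simp
qed

text \<open>The identity has zero bracket with \<open>X\<close>, so inner products are constant
  along the one-parameter group.\<close>

lemma orthogonal_matrix_exp: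
  fixes X :: "real^'n^'n"
  assumes "X \<in> so"
  shows "orthogonal_matrix (matrix_exp X)"
proof -
  have "(matrix_exp X *v v) \<bullet> (matrix_exp X *v w) = v \<bullet> w" for v w
  proof -
    define f where "f = (\<lambda>t. (matrix_exp (t *\<^sub>R X) *v v) \<bullet> (mat 1 *v (matrix_exp (t *\<^sub>R X) *v w)))"
    have "(f has_real_derivative 0) (at t)" for t
      using matrix_exp_inner_derivative_so[OF assms, of v "mat 1" w t]
      by (simp add: f_def commutator_def)
    then have "f 1 = f 0" by (intro DERIV_isconst_all) auto
    then show ?thesis by (simp add: f_def)
  qed
  then have "orthogonal_transformation ((*v) (matrix_exp X))"
    by (simp add: orthogonal_transformation_def)
  then show ?thesis
    by (simp add: orthogonal_transformation_matrix)
qed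

text \<open>Differentiate the invariance of the inner product at t = 0.\<close>

lemma so_if_orthogonal_matrix_exp:
  fixes X :: "real^'n^'n"
  assumes "\<And>t. orthogonal_matrix (matrix_exp (t *\<^sub>R X))"
  shows "X \<in> so"
  unfolding mem_so_iff
proof (intro allI)
  fix v w
  have "(matrix_exp (t *\<^sub>R X) *v v) \<bullet> (mat 1 *v (matrix_exp (t *\<^sub>R X) *v w)) = v \<bullet> w" for t
    using assms[of t] orthogonal_transformation_matrix[of "(*v) (matrix_exp (t *\<^sub>R X))"]
    by (simp add: orthogonal_transformation_def)
  then have "((\<lambda>t. v \<bullet> w) has_real_derivative v \<bullet> (X *v w) + (X *v v) \<bullet> w) (at 0)"
    using matrix_exp_inner_derivative[of X v "mat 1" w 0] by simp
  then show "(X *v v) \<bullet> w + v \<bullet> (X *v w) = 0"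
    using DERIV_unique DERIV_const by fastforce
qed

section \<open>The Lie algebra of the orthogonal isometries\<close>

context clifford
begin

lemma matrix_lie_algebra_subset_g6: "matrix_lie_algebra (Iso_QH_O8 A) \<subseteq> g6 A"
proof
  fix X assume "X \<in> matrix_lie_algebra (Iso_QH_O8 A)"
  then have E: "matrix_exp (t *\<^sub>R X) \<in> Iso_QH_O8 A" for t
    by (simp add: matrix_lie_algebra_def)
  then have X: "X \<in> so"
    by (intro so_if_orthogonal_matrix_exp) (simp add: mem_Iso_QH_O8_iff)
  have unit: "commutator (A k) X *v q \<in> quat_line q" if k: "k \<in> {6, 7}" and q: "q \<in> S7" for k q
    unfolding quat_line_D_QH orthogonal_comp_def
  proof (intro CollectI ballI)
    fix v assume v: "v \<in> D_QH A q"
    have "(matrix_exp (t *\<^sub>R X) *v v) \<bullet> (A k *v (matrix_exp (t *\<^sub>R X) *v q)) = 0" for t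
    proof -
      have "matrix_exp (t *\<^sub>R X) *v v \<in> D_QH A (matrix_exp (t *\<^sub>R X) *v q)"
        using E[of t] q v by (simp add: mem_Iso_QH_O8_iff)
      then show ?thesis using k by (auto simp: mem_D_QH_iff)
    qed
    \<comment> \<open>The vanishing function is differentiated at t = 0, where the exponential is
      the identity.\<close>
    then have "((\<lambda>t. 0) has_real_derivative v \<bullet> (commutator (A k) X *v q)) (at 0)"
      using matrix_exp_inner_derivative_so[OF X, of v "A k" q 0] by simp
    from DERIV_unique[OF this DERIV_const] show "orthogonal v (commutator (A k) X *v q)"
      by (simp add: orthogonal_def)
  qed
  \<comment> \<open>The isometry condition concerns unit vectors only; scaling extends the
    conclusion to every q.\<close>
  have "commutator (A k) X *v q \<in> quat_line q" if k: "k \<in> {6, 7}" for k q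
  proof (cases "q = 0")
    case True
    then show ?thesis by (simp add: subspace_0[OF subspace_quat_line])
  next
    case False
    then have "commutator (A k) X *v (q /\<^sub>R norm q) \<in> quat_line (q /\<^sub>R norm q)"
      by (intro unit k) simp
    then obtain M where M: "M \<in> quats" "commutator (A k) X *v (q /\<^sub>R norm q) = M *v (q /\<^sub>R norm q)"
      by (auto simp: quat_line_def)
    then have "commutator (A k) X *v q = M *v q"
      using False by (simp add: matrix_vector_mult.scaleR_right)
    with M(1) show ?thesis by (auto simp: quat_line_def)
  qed
  then show "X \<in> g6 A" by (rule g6_if_commutators_vertical[OF X])
qed

lemma matrix_exp_g6_mem:
  assumes X: "X \<in> g6 A"
  shows "matrix_exp X \<in> Iso_QH_O8 A"
  unfolding mem_Iso_QH_O8_iff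
proof (intro conjI ballI)
  have so: "X \<in> so" using X g6_subset_so by blast
  then show "orthogonal_matrix (matrix_exp X)" by (rule orthogonal_matrix_exp)
  fix q v assume v: "v \<in> D_QH A q"
  define f where "f = (\<lambda>M t. (matrix_exp (t *\<^sub>R X) *v v) \<bullet> (M *v (matrix_exp (t *\<^sub>R X) *v q)))"
  have f': "(f M has_real_derivative f (commutator M X) t) (at t)" for M t
    unfolding f_def by (rule matrix_exp_inner_derivative_so[OF so])
  have lin: "f (a *\<^sub>R M + b *\<^sub>R N) t = a * f M t + b * f N t" for a b M N t
    by (simp add: f_def matrix_vector_mult.add_left matrix_vector_mult.scaleR_left inner_add_right)
  obtain a b c where abc: "commutator (A 6) X = a *\<^sub>R A 7 + b *\<^sub>R (A 6 ** A 7)"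
      "commutator (A 7) X = - a *\<^sub>R A 6 + c *\<^sub>R (A 6 ** A 7)"
      and "commutator (A 6 ** A 7) X = - b *\<^sub>R A 6 - c *\<^sub>R A 7"
    using g6_commutator[OF X] by blast
  then have abc3: "commutator (A 6 ** A 7) X = - b *\<^sub>R A 6 + (- c) *\<^sub>R A 7"
    by simp
  let ?f1 = "f (A 6)" and ?f2 = "f (A 7)" and ?f3 = "f (A 6 ** A 7)"
  \<comment> \<open>The coefficient matrix of the system d1, d2, d3 is skew, so F is conserved.\<close>
  define F where "F = (\<lambda>t. (?f1 t)\<^sup>2 + (?f2 t)\<^sup>2 + (?f3 t)\<^sup>2)"
  have d1: "(?f1 has_real_derivative a * ?f2 t + b * ?f3 t) (at t)"
    and d2: "(?f2 has_real_derivative (- a) * ?f1 t + c * ?f3 t) (at t)"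
    and d3: "(?f3 has_real_derivative (- b) * ?f1 t + (- c) * ?f2 t) (at t)" for t
    using f'[of "A 6" t] f'[of "A 7" t] f'[of "A 6 ** A 7" t] unfolding abc abc3 lin by simp_all
  have "(F has_real_derivative 0) (at t)" for t
    unfolding F_def by (rule derivative_eq_intros d1 d2 d3 refl)+ (simp add: algebra_simps)
  then have "F 1 = F 0" by (intro DERIV_isconst_all) auto
  \<comment> \<open>At time 0 the vector \<open>v\<close> is horizontal at \<open>q\<close>.\<close>
  also have "F 0 = 0" using v by (simp add: F_def f_def mem_D_QH_iff)
  finally have "?f1 1 = 0 \<and> ?f2 1 = 0 \<and> ?f3 1 = 0"
    by (simp add: F_def add_nonneg_eq_0_iff)
  \<comment> \<open>This is the tangency condition: the identity commutes with \<open>X\<close>, so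
    the inner product with the base point is constant.\<close>
  moreover have "(f (mat 1) has_real_derivative 0) (at t)" for t
    using f'[of "mat 1" t] by (simp add: commutator_def f_def)
  then have "f (mat 1) 1 = f (mat 1) 0" by (intro DERIV_isconst_all) auto
  ultimately show "matrix_exp X *v v \<in> D_QH A (matrix_exp X *v q)"
    using v by (simp add: mem_D_QH_iff f_def)
qed

lemma matrix_lie_algebra_eq_g6: "matrix_lie_algebra (Iso_QH_O8 A) = g6 A"
proof
  have "t *\<^sub>R X \<in> g6 A" if "X \<in> g6 A" for X t
    using that by (simp add: g6_def span_scale)
  then show "g6 A \<subseteq> matrix_lie_algebra (Iso_QH_O8 A)"
    using matrix_exp_g6_mem by (auto simp: matrix_lie_algebra_def)
qed (rule matrix_lie_algebra_subset_g6)

end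

section \<open>Invariance of dimension\<close>

text \<open>\<open>Euclidean_space n\<close> consists of sequences vanishing from index n on. If n <
  \<open>DIM('a)\<close>, it is transported to the span of n basis vectors of \<open>'a\<close>,
  where invariance of dimension for subspaces applies; otherwise the bound is trivial.\<close>

lemma subspace_dim_le_Euclidean_space:
  fixes U :: "'a::euclidean_space set" and f :: "'a \<Rightarrow> nat \<Rightarrow> real"
  assumes U: "subspace U" and S: "openin (top_of_set U) S" "S \<noteq> {}"
    and f: "continuous_map (top_of_set S) (Euclidean_space n) f" "inj_on f S"
  shows "dim U \<le> n"
proof (cases "n < DIM('a)")
  case True
  then obtain B :: "'a set" where B: "B \<subseteq> Basis" "card B = n"
    using obtain_subset_with_card_n[of n "Basis :: 'a set"] by auto
  then have fin: "finite B" using finite_Basis finite_subset by blast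
  from ex_bij_betw_nat_finite[OF this] obtain h where h: "bij_betw h {0..<n} B"
    using B by auto
  have hB: "h i \<in> Basis" if "i < n" for i
    using that h B by (auto simp: bij_betw_def)
  define g where "g = (\<lambda>x. \<Sum>i<n. f x i *\<^sub>R h i)"
  have coord: "g x \<bullet> h i = f x i" if "i < n" for x i
  proof -
    have "g x \<bullet> h i = (\<Sum>j<n. f x j * (h j \<bullet> h i))"
      by (simp add: g_def inner_sum_left)
    also have "\<dots> = (\<Sum>j<n. if j = i then f x j else 0)"
    proof (intro sum.cong refl)
      fix j assume "j \<in> {..<n}"
      moreover have "h j = h i \<longleftrightarrow> j = i"
        using h that \<open>j \<in> {..<n}\<close> by (auto simp: bij_betw_def inj_on_def)
      ultimately show "f x j * (h j \<bullet> h i) = (if j = i then f x j else 0)"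
        using hB that by (simp add: inner_Basis)
    qed
    also have "\<dots> = f x i" using that by simp
    finally show ?thesis .
  qed
  have "continuous_on S (\<lambda>x. f x i)" for i
  proof -
    have "continuous_map (top_of_set S) (powertop_real UNIV) f"
      using f(1) by (simp add: Euclidean_space_def continuous_map_in_subtopology)
    then have "continuous_map (top_of_set S) euclideanreal (\<lambda>x. f x i)"
      by (simp add: continuous_map_componentwise_UNIV)
    then show ?thesis by simp
  qed
  then have cont: "continuous_on S g"
    unfolding g_def by (intro continuous_intros)
  have inj: "inj_on g S"
  proof (rule inj_onI)
    fix x y assume xy: "x \<in> S" "y \<in> S" "g x = g y"
    have "f x \<in> topspace (Euclidean_space n)" "f y \<in> topspace (Euclidean_space n)"
      using continuous_map_image_subset_topspace[OF f(1)] xy by auto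
    \<comment> \<open>The sum \<open>g\<close> determines the coordinates below n, and the others
      vanish.\<close>
    then have "f x i = f y i" for i
      using coord[of i x] coord[of i y] xy(3)
      by (cases "i < n") (simp_all add: topspace_Euclidean_space)
    then show "x = y" using f(2) xy by (metis ext inj_onD)
  qed
  have "h i \<in> span B" if "i < n" for i
    using that h by (intro span_base) (auto simp: bij_betw_def)
  then have "g \<in> S \<rightarrow> span B"
    unfolding g_def by (intro Pi_I span_sum span_scale) auto
  then have "dim U \<le> dim (span B)"
    using invariance_of_dimension_subspaces[OF S(1) U subspace_span cont _ inj S(2)] by blast
  also have "\<dots> \<le> card B" using dim_le_card'[OF fin] by simp
  finally show ?thesis using B by simp
next
  case False
  then show ?thesis using dim_subset_UNIV[of U] by linarith
qed

text \<open>Take a chart around one image point, pull its domain back to a nonempty relatively open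
  set, and compose \<open>f\<close> with the chart.\<close>

lemma dim_le_manifold_of_dim:
  fixes U :: "'a::euclidean_space set"
  assumes X: "manifold_of_dim n X" and U: "subspace U"
    and S: "openin (top_of_set U) S" "S \<noteq> {}"
    and f: "continuous_map (top_of_set S) X f" "inj_on f S"
  shows "dim U \<le> n"
proof -
  obtain a where a: "a \<in> S" using S(2) by blast
  then have "f a \<in> topspace X" using continuous_map_image_subset_topspace[OF f(1)] by auto
  then obtain W V where W: "openin X W" "f a \<in> W" "openin (Euclidean_space n) V"
      and hom: "subtopology X W homeomorphic_space subtopology (Euclidean_space n) V"
    using X by (auto simp: manifold_of_dim_def)
  obtain \<phi> \<psi> where "homeomorphic_maps (subtopology X W) (subtopology (Euclidean_space n) V) \<phi> \<psi>"
    using hom by (auto simp: homeomorphic_space_def)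
  then have \<phi>: "continuous_map (subtopology X W) (subtopology (Euclidean_space n) V) \<phi>"
    and inv: "\<And>x. x \<in> topspace (subtopology X W) \<Longrightarrow> \<psi> (\<phi> x) = x"
    by (auto simp: homeomorphic_maps_def)
  define T where "T = {x \<in> S. f x \<in> W}"
  have "openin (top_of_set S) T"
    using openin_continuous_map_preimage[OF f(1) W(1)] by (simp add: T_def)
  then have T: "openin (top_of_set U) T" using S(1) openin_trans by blast
  have "continuous_map (top_of_set T) X f"
    using continuous_map_from_subtopology[OF f(1), of T]
    by (simp add: subtopology_subtopology T_def inf_absorb2 Collect_subset)
  then have fT: "continuous_map (top_of_set T) (subtopology X W) f"
    by (auto simp: continuous_map_in_subtopology T_def)
  have "continuous_map (top_of_set T) (Euclidean_space n) (\<phi> \<circ> f)"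
    using continuous_map_compose[OF fT \<phi>] by (rule continuous_map_into_fulltopology)
  moreover have "inj_on (\<phi> \<circ> f) T"
  proof (rule inj_onI)
    fix x y assume xy: "x \<in> T" "y \<in> T" "(\<phi> \<circ> f) x = (\<phi> \<circ> f) y"
    have "f x \<in> topspace (subtopology X W)" "f y \<in> topspace (subtopology X W)"
      using continuous_map_image_subset_topspace[OF fT] xy by auto
    then have "f x = f y" using inv xy(3) by (metis comp_apply)
    then show "x = y" using f(2) xy by (auto simp: T_def dest: inj_onD)
  qed
  moreover have "T \<noteq> {}" using a W by (auto simp: T_def)
  ultimately show ?thesis using subspace_dim_le_Euclidean_space[OF U T] by blast
qed

section \<open>Matrix actions in the uniform metric\<close>

lemma matrix_action_mem_cfunspace:
  "restrict ((*v) Q) (sphere 0 1) \<in> mspace (cfunspace (top_of_set (sphere 0 1)) euclidean_metric)"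
  for Q :: "real^'n^'n"
proof -
  have "continuous_on (sphere 0 1) (restrict ((*v) Q) (sphere 0 1))"
    by (rule continuous_on_eq[OF matrix_vector_mult_linear_continuous_on]) auto
  then show ?thesis
    by (subst compactin_mspace_cfunspace) (auto simp: compactin_subtopology mtopology_of_euclidean)
qed

text \<open>The Frobenius norm dominates the operator norm on unit vectors. Lipschitz bounds for the
  exponential thereby become continuity in the uniform topology.\<close>

lemma mdist_matrix_action_le:
  "mdist (cfunspace (top_of_set (sphere 0 1)) euclidean_metric)
     (restrict ((*v) P) (sphere 0 1)) (restrict ((*v) Q) (sphere 0 1)) \<le> norm (P - Q)"
  for P Q :: "real^'n^'n"
proof (rule mdist_cfunspace_le)
  fix x :: "real^'n" assume "x \<in> topspace (top_of_set (sphere 0 1))"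
  then have x: "norm x = 1" by simp
  have "norm ((P - Q) *v x) \<le> norm (P - Q)"
    using norm_matrix_vector_mult_le[of "P - Q" x] x by simp
  then show "mdist euclidean_metric (restrict ((*v) P) (sphere 0 1) x) (restrict ((*v) Q) (sphere 0 1) x)
      \<le> norm (P - Q)"
    using x by (simp add: dist_norm matrix_vector_mult.diff_left)
qed simp

context clifford
begin

lemma dim_g6_le_manifold_dim:
  assumes "manifold_of_dim n (uniform_topology S7 (Iso_QH A))"
  shows "dim (g6 A) \<le> n"
proof (rule dim_le_manifold_of_dim[OF assms])
  define \<Phi> where "\<Phi> = (\<lambda>X. restrict ((*v) (matrix_exp X)) S7)"
  \<comment> \<open>Radius 1/4 is the one for which \<open>matrix_exp_local\<close> gives
    injectivity and Lipschitz constant 2.\<close>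
  define S where "S = g6 A \<inter> ball 0 (1/4)"
  show "subspace (g6 A)" by (simp add: g6_def)
  show "openin (top_of_set (g6 A)) S" by (auto simp: S_def openin_open)
  have "0 \<in> g6 A" by (simp add: g6_def span_zero)
  then have "0 \<in> S" by (simp add: S_def)
  then show "S \<noteq> {}" by blast
  have S: "norm X \<le> 1/4" if "X \<in> S" for X using that by (simp add: S_def)
  show "inj_on \<Phi> S"
  proof (rule inj_onI)
    fix X Y assume XY: "X \<in> S" "Y \<in> S" "\<Phi> X = \<Phi> Y"
    have unit: "matrix_exp X *v q = matrix_exp Y *v q" if "norm q = 1" for q
      using fun_cong[OF XY(3), of q] that by (simp add: \<Phi>_def)
    \<comment> \<open>A linear map is determined by its values on the sphere.\<close>
    have "matrix_exp X *v q = matrix_exp Y *v q" for q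
    proof (cases "q = 0")
      case False
      then show ?thesis using unit[of "q /\<^sub>R norm q"] by (simp add: matrix_vector_mult.scaleR_right)
    qed simp
    then have "matrix_exp X = matrix_exp Y" by (simp add: matrix_eq)
    then show "X = Y" using matrix_exp_local(2) S XY by blast
  qed
  show "continuous_map (top_of_set S) (uniform_topology S7 (Iso_QH A)) \<Phi>"
    unfolding uniform_topology_def continuous_map_in_subtopology
  proof
    let ?m = "cfunspace (top_of_set S7) (euclidean_metric :: (real^8) metric)"
    interpret m: Metric_space "mspace ?m" "mdist ?m" by (rule Metric_space_mspace_mdist)
    show "\<Phi> \<in> topspace (top_of_set S) \<rightarrow> Iso_QH A"
      using matrix_exp_g6_mem by (auto simp: \<Phi>_def S_def Iso_QH_O8_def)
    show "continuous_map (top_of_set S) (mtopology_of ?m) \<Phi>"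
      unfolding mtopology_of_def m.continuous_map_to_metric
    proof (intro ballI allI impI)
      fix X and e :: real assume X: "X \<in> topspace (top_of_set S)" and "0 < e"
      \<comment> \<open>Radius e/2 compensates the Lipschitz constant 2.\<close>
      have "\<Phi> Y \<in> m.mball (\<Phi> X) e" if "Y \<in> S \<inter> ball X (e/2)" for Y
      proof -
        have "mdist ?m (\<Phi> X) (\<Phi> Y) \<le> norm (matrix_exp X - matrix_exp Y)"
          unfolding \<Phi>_def by (rule mdist_matrix_action_le)
        also have "\<dots> \<le> 2 * norm (X - Y)"
          using X that S by (intro matrix_exp_local) auto
        also have "\<dots> < e" using that by (simp add: dist_norm)
        finally show ?thesis
          unfolding m.in_mball \<Phi>_def using matrix_action_mem_cfunspace by blast
      qed
      moreover have "openin (top_of_set S) (S \<inter> ball X (e/2))" by (auto simp: openin_open)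
      moreover have "X \<in> S \<inter> ball X (e/2)" using X \<open>0 < e\<close> by simp
      ultimately show "\<exists>U. openin (top_of_set S) U \<and> X \<in> U \<and> (\<forall>Y\<in>U. \<Phi> Y \<in> m.mball (\<Phi> X) e)"
        by blast
    qed
  qed
qed

end

theorem theorem5p11:
  fixes A :: "nat \<Rightarrow> real^8^8"
  assumes "clifford_family A"
  shows "g6 A \<subseteq> so \<and>
         matrix_lie_algebra (Iso_QH_O8 A) = g6 A \<and>
         dim (g6 A) = 13 \<and>
         (\<forall>n. manifold_of_dim n (uniform_topology S7 (Iso_QH A)) \<longrightarrow> dim (g6 A) \<le> n)"
proof -
  interpret clifford A by unfold_locales (rule assms)
  show ?thesis
    using g6_subset_so matrix_lie_algebra_eq_g6 dim_g6 dim_g6_le_manifold_dim by blast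
qed

end
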